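(* There exist constants $c, C > 0$ such that for all integers $r \geq 2$, $$ c\, r^2 \ln r \;\leq\; s_r(K_3) \;\leq\; C\, r^2 (\ln r)^2 .$$
   Context: All graphs are finite and simple. For graphs $G,H$ and an integer $r\ge 1$, write $G \rightarrow (H)_r$ ("$G$ is $r$-Ramsey for $H$") if every colouring of the edges of $G$ with $r$ colours contains a monochromatic copy of $H$. A graph $G$ is $r$-Ramsey-minimal for $H$ if $G \rightarrow (H)_r$ but no proper subgraph $G' \subsetneq G$ satisfies $G' \rightarrow (H)_r$. Let $\mathcal{M}_r(H)$ be the family of all graphs that are $r$-Ramsey-minimal for $H$, and define $s_r(H) := \min_{G \in \mathcal{M}_r(H)} \delta(G)$, where $\delta(G)$ is the minimum degree of $G$. $K_k$ denotes the complete graph on $k$ vertices. *)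

theory Defs
  imports Complex_Main
begin

text \<open>A finite simple graph: finite vertex set V and a set E of 2-element subsets of V.
  Host graphs G range over graphs with vertices in nat (every finite graph is isomorphic
  to such a graph).\<close>

definition is_graph :: "'a set \<Rightarrow> 'a set set \<Rightarrow> bool" where
  "is_graph V E \<longleftrightarrow> finite V \<and> (\<forall>e\<in>E. e \<subseteq> V \<and> card e = 2)"

definition is_subgraph :: "'a set \<Rightarrow> 'a set set \<Rightarrow> 'a set \<Rightarrow> 'a set set \<Rightarrow> bool" where
  "is_subgraph V' E' V E \<longleftrightarrow> is_graph V' E' \<and> V' \<subseteq> V \<and> E' \<subseteq> E"

definition has_copy :: "'a set \<Rightarrow> 'a set set \<Rightarrow> 'b set \<Rightarrow> 'b set set \<Rightarrow> bool" where
  "has_copy V F VH EH \<longleftrightarrow>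
     (\<exists>f. inj_on f VH \<and> f ` VH \<subseteq> V \<and> (\<forall>e\<in>EH. f ` e \<in> F))"

definition ramsey :: "nat \<Rightarrow> 'a set \<Rightarrow> 'a set set \<Rightarrow> 'b set \<Rightarrow> 'b set set \<Rightarrow> bool" where
  "ramsey r V E VH EH \<longleftrightarrow>
     (\<forall>col :: 'a set \<Rightarrow> nat. (\<forall>e\<in>E. col e < r) \<longrightarrow>
        (\<exists>i<r. has_copy V {e\<in>E. col e = i} VH EH))"

definition ramsey_minimal :: "nat \<Rightarrow> 'a set \<Rightarrow> 'a set set \<Rightarrow> 'b set \<Rightarrow> 'b set set \<Rightarrow> bool" where
  "ramsey_minimal r V E VH EH \<longleftrightarrow>
     is_graph V E \<and> ramsey r V E VH EH \<and>
     (\<forall>V' E'. is_subgraph V' E' V E \<and> (V', E') \<noteq> (V, E) \<longrightarrow> \<not> ramsey r V' E' VH EH)"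

definition degree :: "'a set set \<Rightarrow> 'a \<Rightarrow> nat" where
  "degree E v = card {e\<in>E. v \<in> e}"

definition min_degree :: "'a set \<Rightarrow> 'a set set \<Rightarrow> nat" where
  "min_degree V E = Min (degree E ` V)"

definition s_r :: "nat \<Rightarrow> 'b set \<Rightarrow> 'b set set \<Rightarrow> nat" where
  "s_r r VH EH = Inf {min_degree V E | (V :: nat set) E. ramsey_minimal r V E VH EH}"

definition K3_V :: "nat set" where "K3_V = {0, 1, 2}"
definition K3_E :: "nat set set" where "K3_E = {{0, 1}, {0, 2}, {1, 2}}"

end

theory Submission
  imports Defs "HOL-Library.Ramsey"
begin

text \<open>Lower bound: delete a vertex of minimum degree from a minimal graph and take a good colouring of
  the rest. The colours give edge-disjoint triangle-free graphs on the neighbourhood, and since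
  triangle-free graphs on \<open>m\<close> vertices have independent sets of size of order \<open>sqrt (m * ln m)\<close>, a
  greedy procedure splits a small neighbourhood into sets \<open>V\<^sub>i\<close> that are independent in the graph of
  colour \<open>i\<close>. Colouring the deleted edges accordingly extends the good colouring.

  Upper bound: a random edge colouring of a complete graph, purged of a maximal family of
  edge-disjoint monochromatic triangles in each colour, yields \<open>r\<close> edge-disjoint triangle-free graphs on
  \<open>n\<close> vertices, each with independence number below \<open>n / r\<close>. By a Ramsey theorem for graphs with typed
  edges and no triangle of a single type, proved by a partite construction, some graph \<open>F\<close> has a
  good colouring, and every good colouring of \<open>F\<close> contains a homomorphic image of this pattern.
  Joining a new vertex to each set of at most \<open>n\<close> vertices of \<open>F\<close> gives a Ramsey graph in which every
  minimal subgraph uses a new vertex. Only homomorphic images, not copies, of the pattern are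
  needed, which makes signal senders and the Hales-Jewett theorem unnecessary.\<close>

section \<open>Independent sets in triangle-free graphs\<close>

text \<open>The scales in the upper bound are forced. With \<open>R\<close> colours a
  \<open>k\<close>-set has about \<open>k ^ 2 / (2 * R)\<close> edges of one colour, and beating the
  number of \<open>k\<close>-sets requires \<open>k\<close> of order \<open>R * ln r\<close>. An
  edge lies in about \<open>n / R ^ 2\<close> triangles of its own colour, which must stay a small
  constant if purging is to spare most edges; with \<open>n = k * r\<close> this requires
  \<open>R\<close> of order \<open>r * ln r\<close>. Only \<open>r\<close> of the \<open>R\<close>
  colours are kept, and \<open>n\<close> has order \<open>(r * ln r) ^ 2\<close>. Independence
  number below \<open>k = n / r\<close> makes the pattern unavoidable: whatever \<open>r\<close>
  colours a new vertex sends to it, some colour reaches \<open>k\<close> vertices, and these span an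
  edge of the corresponding type. Homomorphisms preserve this, since colours at the images pull back
  to the pattern and, there being no loops, no edge collapses.\<close>

text \<open>Divided by \<open>2 ^ x + 1\<close>, the left side is the mean of a variable worth
  \<open>d\<close> in one case and \<open>card Z\<close> for each subset \<open>Z\<close> of an
  \<open>x\<close>-set. If \<open>x\<close> is at least \<open>ln d / 2\<close>, the subsets, of
  mean size \<open>x / 2\<close>, suffice; otherwise \<open>2 ^ x \<le> sqrt d\<close>, and the
  single case of value \<open>d\<close> does.\<close>

lemma hard_core_local_bound:
  fixes d :: real and x :: nat
  assumes "d \<ge> 1"
  shows "d + real x * 2 ^ x / 2 \<ge> (ln d / 8) * (2 ^ x + 1)"
proof -
  define b where "b = ln d / 8"
  have b0: "b \<ge> 0" using assms by (simp add: b_def)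
  show ?thesis
  proof (cases "real x \<ge> 4 * b")
    case True
    have "b * (2 ^ x + 1) \<le> b * (2 * 2 ^ x)" using b0 by (intro mult_left_mono) auto
    also have "\<dots> = 4 * b * 2 ^ x / 2" by simp
    also have "\<dots> \<le> real x * 2 ^ x / 2" using True by (simp add: mult_right_mono)
    finally show ?thesis using assms by (simp add: b_def)
  next
    case False
    have "real x * ln 2 \<le> (4 * b) * 1"
      using False b0 ln_2_less_1 by (intro mult_mono) auto
    also have "\<dots> = ln d / 2" by (simp add: b_def)
    finally have "exp (real x * ln 2) \<le> exp (ln d / 2)" by simp
    moreover have "exp (real x * ln 2) = 2 ^ x"
      by (metis exp_ln exp_of_nat_mult zero_less_numeral)
    moreover have "exp (ln d / 2) = sqrt d"
      using assms by (simp add: ln_sqrt [symmetric])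
    ultimately have px: "2 ^ x \<le> sqrt d" by simp
    have "ln (sqrt d) \<le> sqrt d - 1" using assms by (intro ln_le_minus_one) auto
    then have bd: "b \<le> (sqrt d - 1) / 4" using assms by (simp add: b_def ln_sqrt)
    have "b * (2 ^ x + 1) \<le> (sqrt d - 1) / 4 * (sqrt d + 1)"
      using b0 bd px assms by (intro mult_mono) auto
    also have "\<dots> = (sqrt d * sqrt d - 1) / 4" by (simp add: algebra_simps)
    also have "\<dots> = (d - 1) / 4" using assms by (subst real_sqrt_mult_self) auto
    also have "\<dots> \<le> d" using assms by simp
    finally show ?thesis by (simp add: b_def add_increasing2)
  qed
qed

lemma sum_card_Pow:
  assumes "finite A"
  shows "(\<Sum>Z\<in>Pow A. real (card Z)) = real (card A) * 2 ^ card A / 2"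
  using assms
proof (induction A rule: finite_induct)
  case (insert a A)
  have "(\<Sum>Z\<in>Pow (insert a A). real (card Z))
      = (\<Sum>Z\<in>Pow A. real (card Z)) + (\<Sum>Z\<in>insert a ` Pow A. real (card Z))"
    unfolding Pow_insert using insert by (intro sum.union_disjoint) auto
  also have "(\<Sum>Z\<in>insert a ` Pow A. real (card Z)) = (\<Sum>Z\<in>Pow A. real (card (insert a Z)))"
    using insert by (intro sum.reindex_cong[where l="insert a"]) (auto simp: inj_on_def)
  also have "\<dots> = (\<Sum>Z\<in>Pow A. real (card Z) + 1)"
    using insert by (intro sum.cong) (auto simp: finite_subset subset_iff card_insert_if)
  also have "\<dots> = (\<Sum>Z\<in>Pow A. real (card Z)) + 2 ^ card A"
    using insert by (simp add: sum.distrib card_Pow)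
  finally show ?case using insert by (simp add: algebra_simps add_divide_distrib)
qed simp

definition independent_in :: "('a \<Rightarrow> 'a \<Rightarrow> bool) \<Rightarrow> 'a set \<Rightarrow> bool" where
  "independent_in adj W \<longleftrightarrow> (\<forall>x\<in>W. \<forall>y\<in>W. \<not> adj x y)"

text \<open>The three vertices may coincide, so loops are excluded as well.\<close>

definition triangle_free_on :: "'a set \<Rightarrow> ('a \<Rightarrow> 'a \<Rightarrow> bool) \<Rightarrow> bool" where
  "triangle_free_on V adj \<longleftrightarrow> (\<forall>x\<in>V. \<forall>y\<in>V. \<forall>z\<in>V. \<not> (adj x y \<and> adj y z \<and> adj x z))"

lemma triangle_free_on_subset:
  "triangle_free_on V adj \<Longrightarrow> U \<subseteq> V \<Longrightarrow> triangle_free_on U adj"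
  unfolding triangle_free_on_def by blast

lemma triangle_free_on_irrefl:
  "triangle_free_on V adj \<Longrightarrow> x \<in> V \<Longrightarrow> \<not> adj x x"
  unfolding triangle_free_on_def by blast

lemma independent_in_neighbourhood:
  assumes "symp adj" "triangle_free_on V adj" "v \<in> V"
  shows "independent_in adj {u\<in>V. adj v u}"
  using assms unfolding independent_in_def triangle_free_on_def by blast

text \<open>The vertex \<open>v\<close> contributes \<open>d\<close> times its own membership in a random independent set
  plus the number of its neighbours in it; conditioning on the set outside the closed
  neighbourhood of \<open>v\<close> leaves \<open>2 ^ x + 1\<close> equally likely cases.\<close>

lemma local_occupancy_sum:
  fixes d :: real
  assumes fin: "finite V" and sym: "symp adj" and tf: "triangle_free_on V adj"
    and v: "v \<in> V" and d: "d \<ge> 1"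
  defines "I \<equiv> {W. W \<subseteq> V \<and> independent_in adj W}"
    and "N \<equiv> {u\<in>V. adj v u}"
  shows "(\<Sum>W\<in>I. (if v \<in> W then d else 0) + real (card (N \<inter> W))) \<ge> real (card I) * (ln d / 8)"
proof -
  define X where "X W = (if v \<in> W then d else 0) + real (card (N \<inter> W))" for W
  define p where "p W = W - insert v N" for W
  have finI: "finite I" unfolding I_def using fin by simp
  have vN: "v \<notin> N" using triangle_free_on_irrefl[OF tf v] by (simp add: N_def)
  have finN: "finite N" using fin by (simp add: N_def)
  have fibre: "real (card {W\<in>I. p W = U}) * (ln d / 8) \<le> (\<Sum>W\<in>{W\<in>I. p W = U}. X W)"
    if U: "U \<in> p ` I" for U
  proof -
    \<comment> \<open>The neighbours of \<open>v\<close> not blocked by \<open>U\<close>. Neither is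
      \<open>v\<close> itself blocked, and the neighbourhood is independent, so the fibre consists
      of \<open>insert v U\<close> and all \<open>U \<union> Z\<close> with
      \<open>Z \<subseteq> M\<close>.\<close>
    define M where "M = {u\<in>N. \<forall>w\<in>U. \<not> adj u w}"
    have UV: "U \<subseteq> V" "independent_in adj U" "U \<inter> insert v N = {}"
      using U by (auto simp: p_def I_def independent_in_def)
    have finM: "finite M" "M \<subseteq> N" using finN by (auto simp: M_def)
    have indN: "independent_in adj N"
      unfolding N_def by (rule independent_in_neighbourhood[OF sym tf v])
    have vU: "\<not> adj v w" "\<not> adj w v" if "w \<in> U" for w
      using that UV sym by (auto simp: N_def dest: sympD)
    have eq: "{W\<in>I. p W = U} = insert (insert v U) ((\<lambda>Z. U \<union> Z) ` Pow M)" (is "?L = ?R")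
    proof
      show "?L \<subseteq> ?R"
      proof
        fix W assume W: "W \<in> ?L"
        then have WV: "W \<subseteq> V" "independent_in adj W" and pW: "W - insert v N = U"
          by (auto simp: I_def p_def)
        show "W \<in> ?R"
        proof (cases "v \<in> W")
          case True
          then have "W \<inter> N = {}" using WV by (auto simp: independent_in_def N_def)
          then have "W = insert v U" using True pW by auto
          then show ?thesis by simp
        next
          case False
          have "W = U \<union> (W \<inter> N)" using pW False by auto
          moreover have "W \<inter> N \<subseteq> M"
            using WV pW by (auto simp: M_def independent_in_def)
          ultimately show ?thesis by blast
        qed
      qed
      have "insert v U \<in> ?L"
        using UV v vU triangle_free_on_irrefl[OF tf v]
        by (auto simp: I_def p_def independent_in_def)
      moreover have "U \<union> Z \<in> ?L" if "Z \<subseteq> M" for Z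
      proof -
        have "independent_in adj (U \<union> Z)"
          using UV indN that finM sym unfolding independent_in_def M_def
          by (auto dest: sympD; blast dest: sympD)
        then show ?thesis using that finM UV by (auto simp: I_def p_def N_def)
      qed
      ultimately show "?R \<subseteq> ?L" by auto
    qed
    have vnot: "insert v U \<notin> (\<lambda>Z. U \<union> Z) ` Pow M"
      using vN finM UV by auto
    have inj: "inj_on (\<lambda>Z. U \<union> Z) (Pow M)"
      using finM(2) UV(3) unfolding inj_on_def by blast
    have finR: "finite ((\<lambda>Z. U \<union> Z) ` Pow M)" using finM by simp
    have "card {W\<in>I. p W = U} = 2 ^ card M + 1"
      unfolding eq using vnot finR inj finM by (simp add: card_image card_Pow)
    moreover have "(\<Sum>W\<in>{W\<in>I. p W = U}. X W) = X (insert v U) + (\<Sum>Z\<in>Pow M. X (U \<union> Z))"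
      unfolding eq using vnot finR inj by (simp add: sum.reindex)
    moreover have "X (insert v U) = d"
    proof -
      have "N \<inter> insert v U = {}" using UV vN by auto
      then show ?thesis by (simp add: X_def)
    qed
    moreover have "(\<Sum>Z\<in>Pow M. X (U \<union> Z)) = (\<Sum>Z\<in>Pow M. real (card Z))"
    proof (intro sum.cong refl)
      fix Z assume "Z \<in> Pow M"
      then have "N \<inter> (U \<union> Z) = Z" "v \<notin> U \<union> Z" using UV finM vN by auto
      then show "X (U \<union> Z) = real (card Z)" by (simp add: X_def)
    qed
    ultimately show ?thesis
      using hard_core_local_bound[OF d, of "card M"] sum_card_Pow[OF finM(1)]
      by (simp add: algebra_simps)
  qed
  have "real (card I) * (ln d / 8) = (\<Sum>U\<in>p ` I. real (card {W\<in>I. p W = U})) * (ln d / 8)"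
    using sum.image_gen[OF finI, of "\<lambda>_. 1::real" p] by simp
  also have "\<dots> = (\<Sum>U\<in>p ` I. real (card {W\<in>I. p W = U}) * (ln d / 8))"
    by (rule sum_distrib_right)
  also have "\<dots> \<le> (\<Sum>U\<in>p ` I. \<Sum>W\<in>{W\<in>I. p W = U}. X W)"
    by (rule sum_mono) (rule fibre)
  also have "\<dots> = (\<Sum>W\<in>I. X W)" using sum.image_gen[OF finI, of X p] by simp
  finally show ?thesis by (simp add: X_def)
qed

text \<open>Shearer's averaging argument: summed over \<open>v\<close>, the local bound gives at
  least \<open>card V * ln d / 8\<close> on average over the independent sets \<open>W\<close>,
  while one \<open>W\<close> contributes at most \<open>2 * d * card W\<close>, namely
  \<open>d\<close> for each member and at most \<open>d\<close> for the neighbours of each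
  member.\<close>

lemma independent_set_bounded_degree:
  fixes d :: real
  assumes fin: "finite V" and sym: "symp adj" and tf: "triangle_free_on V adj"
    and deg: "\<And>v. v \<in> V \<Longrightarrow> real (card {u\<in>V. adj v u}) \<le> d" and d: "d \<ge> 1"
  obtains W where "W \<subseteq> V" "independent_in adj W" "real (card W) \<ge> real (card V) * ln d / (16 * d)"
proof -
  define I where "I = {W. W \<subseteq> V \<and> independent_in adj W}"
  define N where "N v = {u\<in>V. adj v u}" for v
  have finI: "finite I" unfolding I_def using fin by simp
  have upper: "(\<Sum>v\<in>V. (if v \<in> W then d else 0) + real (card (N v \<inter> W))) \<le> 2 * d * real (card W)"
    if "W \<in> I" for W
  proof -
    have WV: "W \<subseteq> V" using that by (simp add: I_def)
    have finW: "finite W" using WV fin by (rule finite_subset)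
    have "(\<Sum>v\<in>V. if v \<in> W then d else 0) = d * real (card W)"
      using fin WV by (simp add: sum.If_cases Int_absorb1)
    moreover have "(\<Sum>v\<in>V. real (card (N v \<inter> W))) = (\<Sum>u\<in>W. real (card (N u)))"
    proof -
      have "(\<Sum>v\<in>V. real (card (N v \<inter> W))) = (\<Sum>v\<in>V. \<Sum>u\<in>W. if adj v u then 1 else 0)"
      proof (intro sum.cong refl)
        fix v assume "v \<in> V"
        have "N v \<inter> W = {u\<in>W. adj v u}" using WV by (auto simp: N_def)
        then show "real (card (N v \<inter> W)) = (\<Sum>u\<in>W. if adj v u then 1 else 0)"
          using finW by (simp add: sum.If_cases Int_def)
      qed
      also have "\<dots> = (\<Sum>u\<in>W. \<Sum>v\<in>V. if adj v u then 1 else 0)" by (rule sum.swap)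
      also have "\<dots> = (\<Sum>u\<in>W. real (card (N u)))"
      proof (intro sum.cong refl)
        fix u
        have "{v\<in>V. adj v u} = N u" using sym by (auto simp: N_def dest: sympD)
        then show "(\<Sum>v\<in>V. if adj v u then 1 else 0) = real (card (N u))"
          using fin by (simp add: sum.If_cases Int_def)
      qed
      finally show ?thesis .
    qed
    moreover have "(\<Sum>u\<in>W. real (card (N u))) \<le> (\<Sum>u\<in>W. d)"
      using deg WV by (intro sum_mono) (auto simp: N_def)
    ultimately show ?thesis by (simp add: sum.distrib algebra_simps)
  qed
  have "real (card V) * (real (card I) * (ln d / 8))
      \<le> (\<Sum>v\<in>V. \<Sum>W\<in>I. (if v \<in> W then d else 0) + real (card (N v \<inter> W)))"
    unfolding I_def N_def
    by (intro sum_bounded_below local_occupancy_sum[OF fin sym tf _ d])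
  also have "\<dots> = (\<Sum>W\<in>I. \<Sum>v\<in>V. (if v \<in> W then d else 0) + real (card (N v \<inter> W)))"
    by (rule sum.swap)
  also have "\<dots> \<le> (\<Sum>W\<in>I. 2 * d * real (card W))" by (rule sum_mono) (rule upper)
  finally have tot: "real (card V) * (real (card I) * (ln d / 8)) \<le> (\<Sum>W\<in>I. 2 * d * real (card W))" .
  have ne: "{} \<in> I" by (simp add: I_def independent_in_def)
  have "\<exists>W\<in>I. real (card W) \<ge> real (card V) * ln d / (16 * d)"
  proof (rule ccontr)
    assume "\<not> ?thesis"
    then have "2 * d * real (card W) < real (card V) * ln d / 8" if "W \<in> I" for W
      using that d by (auto simp: not_le field_simps)
    then have "(\<Sum>W\<in>I. 2 * d * real (card W)) < (\<Sum>W\<in>I. real (card V) * ln d / 8)"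
      using finI ne by (intro sum_strict_mono) auto
    then show False using tot by (simp add: algebra_simps)
  qed
  then show thesis using that by (auto simp: I_def)
qed

text \<open>A neighbourhood is independent, so a vertex of degree at least
  \<open>D = sqrt (m * ln m)\<close> settles the matter. Otherwise \<open>D\<close> bounds all
  degrees, and \<open>m * ln D / (16 * D)\<close> has the same order because
  \<open>ln D \<ge> ln m / 2\<close>; this \<open>D\<close> balances the two cases.\<close>

lemma independent_set_triangle_free:
  assumes fin: "finite V" and sym: "symp adj" and tf: "triangle_free_on V adj"
    and m: "card V \<ge> 3"
  obtains W where "W \<subseteq> V" "independent_in adj W"
    "real (card W) \<ge> sqrt (real (card V) * ln (real (card V))) / 32"
proof -
  define m where "m = real (card V)"
  define D where "D = sqrt (m * ln m)"
  have m3: "m \<ge> 3" using m by (simp add: m_def)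
  have l1: "ln m \<ge> 1"
    using m3 by (subst ln_ge_iff) (use exp_le in auto)
  have "m * ln m \<ge> m * 1" using m3 l1 by (intro mult_left_mono) auto
  then have mm: "m * ln m \<ge> m" by simp
  have "m * ln m \<ge> 1" using mm m3 by linarith
  then have D1: "D \<ge> 1" by (simp add: D_def)
  have DD: "D * D = m * ln m" unfolding D_def using mm m3 by simp
  show thesis
  proof (cases "\<exists>v\<in>V. real (card {u\<in>V. adj v u}) \<ge> D")
    case True
    then obtain v where "v \<in> V" "real (card {u\<in>V. adj v u}) \<ge> D" by blast
    moreover have "D \<ge> D / 32" using D1 by simp
    ultimately show thesis
      using that[of "{u\<in>V. adj v u}"] independent_in_neighbourhood[OF sym tf]
      unfolding D_def m_def by fastforce
  next
    case False
    then obtain W where W: "W \<subseteq> V" "independent_in adj W"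
        "real (card W) \<ge> real (card V) * ln D / (16 * D)"
      using independent_set_bounded_degree[OF fin sym tf _ D1] by (metis linear)
    have "ln m \<le> ln (m * ln m)" using mm m3 by simp
    then have "ln m / 2 \<le> ln D" unfolding D_def using mm m3 by (simp add: ln_sqrt)
    then have "m * (ln m / 2) / (16 * D) \<le> m * ln D / (16 * D)"
      using m3 D1 by (intro divide_right_mono mult_left_mono) auto
    moreover have "m * (ln m / 2) / (16 * D) = D / 32"
      using DD D1 by (simp add: field_simps)
    ultimately have "D / 32 \<le> real (card W)" using W(3) unfolding m_def by linarith
    then show thesis using that[OF W(1,2)] unfolding D_def m_def by blast
  qed
qed


section \<open>Greedy partition into independent sets, one per colour\<close>

text \<open>The potential is the square root of the number of vertices left: removing about
  \<open>sqrt (m * ln m)\<close> of \<open>m\<close> vertices lowers \<open>sqrt m\<close> by order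
  \<open>sqrt (ln m)\<close>, so every colour gains at least a fixed \<open>\<delta>\<close> until
  the root reaches \<open>s\<close>. Colours are spent from the top index down, to match the
  induction on \<open>j\<close>.\<close>

lemma greedy_colouring:
  fixes s \<delta> :: real
  assumes step: "\<And>i U. \<lbrakk>i < j; U \<subseteq> V; sqrt (real (card U)) > s\<rbrakk> \<Longrightarrow>
      \<exists>W\<subseteq>U. independent_in (adj i) W \<and> sqrt (real (card (U - W))) \<le> sqrt (real (card U)) - \<delta>"
    and "U \<subseteq> V" "sqrt (real (card U)) \<le> s + real j * \<delta>"
  shows "\<exists>U'\<subseteq>U. \<exists>g. sqrt (real (card U')) \<le> s \<and>
      (\<forall>x\<in>U - U'. g x < j) \<and> (\<forall>i<j. independent_in (adj i) {x\<in>U - U'. g x = i})"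
  using assms
proof (induction j arbitrary: U)
  case 0
  then show ?case by auto
next
  case (Suc j)
  show ?case
  proof (cases "sqrt (real (card U)) \<le> s")
    case True
    then show ?thesis by (intro exI[of _ U]) (auto simp: independent_in_def)
  next
    case False
    then obtain W where W: "W \<subseteq> U" "independent_in (adj j) W"
        "sqrt (real (card (U - W))) \<le> sqrt (real (card U)) - \<delta>"
      using Suc.prems(1)[of j U] Suc.prems(2) by auto
    have "sqrt (real (card (U - W))) \<le> s + real j * \<delta>"
      using W(3) Suc.prems(3) by (simp add: algebra_simps)
    then obtain U' g where U': "U' \<subseteq> U - W" "sqrt (real (card U')) \<le> s"
        "\<forall>x\<in>U - W - U'. g x < j" "\<forall>i<j. independent_in (adj i) {x\<in>U - W - U'. g x = i}"
      using Suc.IH[OF Suc.prems(1), of "U - W"] Suc.prems(2) by auto blast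
    define g' where "g' x = (if x \<in> W then j else g x)" for x
    have "g x \<noteq> j" if "x \<in> U - W - U'" for x using U'(3) that by blast
    then have "{x\<in>U - U'. g' x = j} = W"
      using W(1) U'(1) by (auto simp: g'_def)
    moreover have "{x\<in>U - U'. g' x = i} = {x\<in>U - W - U'. g x = i}" if "i < j" for i
      using W(1) U'(1) that by (auto simp: g'_def)
    ultimately have "\<forall>i<Suc j. independent_in (adj i) {x\<in>U - U'. g' x = i}"
      using U'(4) W(2) by (auto simp: less_Suc_eq)
    moreover have "\<forall>x\<in>U - U'. g' x < Suc j"
      using U'(3) by (auto simp: g'_def less_Suc_eq)
    ultimately show ?thesis using U'(1,2) by blast
  qed
qed

lemma sqrt_diff_le:
  fixes m w :: real
  assumes "m > 0" "w \<le> m"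
  shows "sqrt (m - w) \<le> sqrt m - w / (2 * sqrt m)"
proof -
  have "sqrt (m - w) * (2 * sqrt m) = 2 * (sqrt (m - w) * sqrt m)" by simp
  also have "\<dots> \<le> (sqrt (m - w))\<^sup>2 + (sqrt m)\<^sup>2"
    using sum_squares_bound[of "sqrt (m - w)" "sqrt m"] by simp
  also have "\<dots> = 2 * m - w" using assms by simp
  also have "\<dots> = (sqrt m - w / (2 * sqrt m)) * (2 * sqrt m)"
    using assms by (simp add: field_simps)
  finally show ?thesis using assms by (simp add: mult_le_cancel_right)
qed

text \<open>The greedy procedure loses its force on small sets. It therefore gets half of the
  colours and stops at \<open>r / 2\<close> vertices, which then receive distinct colours from the
  other half; a single vertex is independent as there are no loops.\<close>

lemma independent_colouring:
  fixes adj :: "nat \<Rightarrow> 'a \<Rightarrow> 'a \<Rightarrow> bool"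
  assumes r: "r \<ge> 2" and fin: "finite V"
    and sym: "\<And>i. i < r \<Longrightarrow> symp (adj i)"
    and tf: "\<And>i. i < r \<Longrightarrow> triangle_free_on V (adj i)"
    and small: "real (card V) < real r ^ 2 * ln (real r) / 100000"
  obtains g where "\<And>x. x \<in> V \<Longrightarrow> g x < r" "\<And>i. i < r \<Longrightarrow> independent_in (adj i) {x\<in>V. g x = i}"
proof (cases "r < 6")
  case True
  \<comment> \<open>For small \<open>r\<close> the bound is below \<open>1\<close>, which leaves no
    vertices.\<close>
  have "ln (real r) \<le> real r - 1" using r by (intro ln_le_minus_one) auto
  then have "real r ^ 2 * ln (real r) \<le> 6 ^ 2 * 6"
    using r True by (intro mult_mono power_mono) auto
  then have "real r ^ 2 * ln (real r) / 100000 < 1" by simp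
  then have "real (card V) < 1" using small by (rule order.strict_trans[rotated])
  then have "V = {}" using fin by simp
  then show thesis using that[of "\<lambda>_. 0"] by (auto simp: independent_in_def)
next
  case False
  \<comment> \<open>Stopping at \<open>r / 2\<close> keeps
    \<open>ln m \<ge> ln (r / 2) \<ge> ln r / 2\<close>; removing
    \<open>sqrt (m * ln m) / 32\<close> vertices then lowers \<open>sqrt m\<close> by at least
    \<open>sqrt (ln m) / 64 \<ge> \<delta>\<close>.\<close>
  define s where "s = sqrt (real r / 2)"
  define \<delta> where "\<delta> = sqrt (ln (real r) / 2) / 64"
  define q where "q = r div 2"
  have s2: "s * s = real r / 2" by (simp add: s_def)
  have lnr: "ln (real r / 2) \<ge> ln (real r) / 2"
  proof -
    have "ln (real r) / 2 = ln (sqrt (real r))" using False by (simp add: ln_sqrt)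
    also have "sqrt (real r) \<le> real r / 2"
    proof (rule real_le_lsqrt)
      have "4 * real r \<le> real r * real r" using False by (intro mult_right_mono) auto
      then show "real r \<le> (real r / 2)\<^sup>2" by (simp add: power2_eq_square)
    qed (use False in auto)
    then have "ln (sqrt (real r)) \<le> ln (real r / 2)" using False by simp
    finally show ?thesis .
  qed
  have lnpos: "ln (real r) > 0" using False by simp
  have step: "\<exists>W\<subseteq>U. independent_in (adj i) W \<and>
      sqrt (real (card (U - W))) \<le> sqrt (real (card U)) - \<delta>"
    if iq: "i < q" and UV: "U \<subseteq> V" and Us: "sqrt (real (card U)) > s" for i U
  proof -
    define m where "m = real (card U)"
    have finU: "finite U" using fin UV by (rule rev_finite_subset)
    have mr: "m > real r / 2" using Us unfolding s_def m_def by simp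
    then have m3: "card U \<ge> 3" using False unfolding m_def by linarith
    have ir: "i < r" using iq by (simp add: q_def)
    obtain W where W: "W \<subseteq> U" "independent_in (adj i) W" "real (card W) \<ge> sqrt (m * ln m) / 32"
      using independent_set_triangle_free[OF finU sym[OF ir]
          triangle_free_on_subset[OF tf[OF ir] UV] m3] unfolding m_def by metis
    have "ln (real r / 2) \<le> ln m" using mr False by (intro ln_mono) auto
    then have "sqrt (ln (real r) / 2) \<le> sqrt (ln m)" using lnr by simp
    then have "sqrt m * (64 * \<delta>) \<le> sqrt m * sqrt (ln m)"
      unfolding \<delta>_def by (intro mult_left_mono) (auto simp: m_def)
    then have w: "2 * sqrt m * \<delta> \<le> real (card W)"
      using W(3) by (simp add: real_sqrt_mult)
    have mpos: "m > 0" using mr False by simp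
    have cW: "card W \<le> card U" "real (card (U - W)) = m - real (card W)"
      using W(1) finU by (auto simp: m_def card_mono card_Diff_subset finite_subset of_nat_diff)
    have "sqrt (m - real (card W)) \<le> sqrt m - real (card W) / (2 * sqrt m)"
      using mpos cW by (intro sqrt_diff_le) (auto simp: m_def)
    also have "\<dots> \<le> sqrt m - \<delta>"
      using w mpos by (simp add: field_simps)
    finally show ?thesis using W cW unfolding m_def by auto
  qed
  have "sqrt (real (card V)) \<le> s + real q * \<delta>"
  proof -
    \<comment> \<open>The right-hand side equals \<open>r ^ 2 * ln r / 73728\<close>, so the
      constant \<open>100000\<close> is more than enough.\<close>
    have "real (card V) \<le> (real r / 3 * \<delta>)\<^sup>2"
      using small lnpos False by (simp add: \<delta>_def power_mult_distrib power_divide)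
    then have "sqrt (real (card V)) \<le> real r / 3 * \<delta>"
      using lnpos by (intro real_le_lsqrt) (auto simp: \<delta>_def)
    also have "\<dots> \<le> real q * \<delta>"
    proof (intro mult_right_mono)
      have "r \<le> 3 * q" using False unfolding q_def by linarith
      then show "real r / 3 \<le> real q" by linarith
    qed (use lnpos in \<open>auto simp: \<delta>_def\<close>)
    finally show ?thesis by (simp add: s_def add_increasing)
  qed
  then have "\<exists>U\<subseteq>V. \<exists>g. sqrt (real (card U)) \<le> s \<and>
      (\<forall>x\<in>V - U. g x < q) \<and> (\<forall>i<q. independent_in (adj i) {x\<in>V - U. g x = i})"
    using step by (intro greedy_colouring[where V=V and \<delta>=\<delta>]) auto
  then obtain U g where U: "U \<subseteq> V" "sqrt (real (card U)) \<le> s"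
      "\<forall>x\<in>V - U. g x < q" "\<forall>i<q. independent_in (adj i) {x\<in>V - U. g x = i}"
    by (elim exE conjE)
  have finU: "finite U" using fin U(1) by (rule rev_finite_subset)
  have "real (card U) \<le> real r / 2" using U(2) by (simp add: s_def)
  then have "card U \<le> card {q..<r}" by (simp add: q_def)
  then obtain k where k: "inj_on k U" "k ` U \<subseteq> {q..<r}"
    using card_le_inj[OF finU] by blast
  define g' where "g' x = (if x \<in> U then k x else g x)" for x
  show thesis
  proof (rule that[of g'])
    show "g' x < r" if "x \<in> V" for x
      using that k U(3) by (force simp: g'_def q_def)
    fix i assume "i < r"
    show "independent_in (adj i) {x\<in>V. g' x = i}"
    proof (cases "i < q")
      case True
      then have "{x\<in>V. g' x = i} = {x\<in>V - U. g x = i}"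
        using k by (force simp: g'_def)
      then show ?thesis using U(4) True by simp
    next
      case ge: False
      have inU: "x \<in> U" if "x \<in> V" "g' x = i" for x
        using that ge U(3) by (cases "x \<in> U") (auto simp: g'_def)
      have eq: "x = y" if x: "x \<in> V" "g' x = i" and y: "y \<in> V" "g' y = i" for x y
      proof (rule inj_onD[OF k(1)])
        show "x \<in> U" "y \<in> U" using inU x y by blast+
        then show "k x = k y" using x(2) y(2) by (simp add: g'_def)
      qed
      show ?thesis
        unfolding independent_in_def
      proof (intro ballI notI)
        fix x y assume "x \<in> {x\<in>V. g' x = i}" "y \<in> {x\<in>V. g' x = i}" "adj i x y"
        then have "x \<in> V" "adj i x x" using eq[of x y] by simp_all
        then show False using triangle_free_on_irrefl[OF tf[OF \<open>i < r\<close>]] by blast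
      qed
    qed
  qed
qed

section \<open>A Ramsey theorem for typed bipartite graphs\<close>

text \<open>The colours form an arbitrary finite set because they will be whole functions: one
  application makes many dependences uniform at once.\<close>

lemma ramsey_nsets_finite_colours:
  fixes C :: "'c set"
  assumes "finite C"
  shows "\<exists>M. \<forall>f. f \<in> nsets {..<M::nat} k \<rightarrow> C \<longrightarrow>
    (\<exists>H\<in>nsets {..<M} h. \<exists>c\<in>C. \<forall>X\<in>nsets H k. f X = c)"
proof -
  obtain e where e: "bij_betw e C {0..<card C}" using assms ex_bij_betw_finite_nat by blast
  obtain M :: nat where M: "partn_lst {..<M} (replicate (card C) h) k" using ramsey_full by blast
  have "\<exists>H\<in>nsets {..<M} h. \<exists>c\<in>C. \<forall>X\<in>nsets H k. f X = c" if f: "f \<in> nsets {..<M} k \<rightarrow> C" for f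
  proof -
    have "(\<lambda>X. e (f X)) \<in> nsets {..<M} k \<rightarrow> {..<card C}"
      using f e by (fastforce simp: bij_betw_def)
    then obtain i H where i: "i < card C" and H: "H \<in> nsets {..<M} h"
        "(\<lambda>X. e (f X)) ` nsets H k \<subseteq> {i}"
      using partn_lstE[OF M] by (metis length_replicate nth_replicate)
    obtain c where c: "c \<in> C" "e c = i"
      using e i by (metis atLeast0LessThan bij_betw_imp_surj_on imageE lessThan_iff)
    have "f X = c" if X: "X \<in> nsets H k" for X
    proof -
      have "H \<subseteq> {..<M}" using H(1) by (simp add: nsets_def)
      then have "f X \<in> C" using nsets_mono X f by blast
      moreover have "e (f X) = e c" using H(2) X c by auto
      ultimately show ?thesis using e c(1) by (auto simp: bij_betw_def inj_on_def)
    qed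
    then show ?thesis using H(1) c(1) by (intro bexI[of _ H] bexI[of _ c]) auto
  qed
  then show ?thesis by (intro exI[of _ M]) blast
qed

lemma pigeonhole_fibre:
  assumes "finite C" "C \<noteq> {}" "f \<in> {..<s * card C} \<rightarrow> C"
  shows "\<exists>c\<in>C. s \<le> card {j\<in>{..<s * card C}. f j = c}"
proof (rule ccontr)
  assume "\<not> ?thesis"
  then have lt: "card {j\<in>{..<s * card C}. f j = c} < s" if "c \<in> C" for c
    using that by (meson not_le)
  have "{..<s * card C} = (\<Union>c\<in>C. {j\<in>{..<s * card C}. f j = c})" using assms(3) by auto
  then have "s * card C = card (\<Union>c\<in>C. {j\<in>{..<s * card C}. f j = c})"
    by (metis card_lessThan)
  also have "\<dots> \<le> (\<Sum>c\<in>C. card {j\<in>{..<s * card C}. f j = c})"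
    using assms(1) by (rule card_UN_le)
  also have "\<dots> < (\<Sum>c\<in>C. s)" using assms(1,2) lt by (intro sum_strict_mono) auto
  finally show False by simp
qed

lemma sorted_list_of_strict_mono_image:
  fixes \<xi> :: "nat \<Rightarrow> nat"
  assumes "strict_mono_on {..<k} \<xi>"
  shows "sorted_list_of_set (\<xi> ` {..<k}) = map \<xi> [0..<k]"
proof -
  have "sorted_wrt (<) (map \<xi> [0..<k])"
    using assms by (auto simp: sorted_wrt_map strict_mono_on_def sorted_wrt_iff_nth_less)
  moreover have "set (map \<xi> [0..<k]) = \<xi> ` {..<k}" by (auto simp: atLeast0LessThan)
  ultimately show ?thesis
    by (metis sorted_list_of_set.idem_if_sorted_distinct strict_sorted_iff)
qed

lemma card_below_strict_mono_image:
  fixes \<xi> :: "nat \<Rightarrow> nat"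
  assumes "strict_mono_on {..<k} \<xi>" "l < k"
  shows "card {y\<in>\<xi> ` {..<k}. y < \<xi> l} = l"
proof -
  have "{y\<in>\<xi> ` {..<k}. y < \<xi> l} = \<xi> ` {..<l}"
    using assms strict_mono_on_less[OF assms(1)] by fastforce
  moreover have "inj_on \<xi> {..<l}"
    using strict_mono_on_imp_inj_on[OF assms(1)] by (rule inj_on_subset) (use assms(2) in auto)
  ultimately show ?thesis by (simp add: card_image)
qed

text \<open>A \<open>k\<close>-set \<open>X\<close> codes the function equal to the rank in \<open>X\<close> modulo \<open>T\<close> on \<open>X\<close> and to
  \<open>T\<close> outside. Ramsey's theorem makes the colour at a point of \<open>X\<close> depend on its rank only, and
  the pigeonhole principle yields \<open>s\<close> blocks of \<open>T\<close> ranks with the same colour pattern. Leaving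
  \<open>2 * T + 1\<close> slots for each block, the block can be shifted so that its central slot receives
  any prescribed value.\<close>

lemma typed_bipartite_universal:
  fixes T r s :: nat
  assumes T: "T \<ge> 1" and r: "r \<ge> 1"
  shows "\<exists>M. \<forall>\<chi> :: nat \<Rightarrow> (nat \<Rightarrow> nat) \<Rightarrow> nat. (\<forall>a f. \<chi> a f < r) \<longrightarrow>
    (\<exists>\<alpha> \<gamma>. inj_on \<alpha> {..<s} \<and> \<alpha> ` {..<s} \<subseteq> {..<M} \<and>
      (\<forall>g. (\<forall>a<s. g a \<le> T) \<longrightarrow> (\<exists>f\<in>{..<M} \<rightarrow>\<^sub>E {..T}.
         \<forall>a<s. f (\<alpha> a) = g a \<and> (g a < T \<longrightarrow> \<chi> (\<alpha> a) f = \<gamma> (g a)))))"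
proof -
  define C where "C = {..<T} \<rightarrow>\<^sub>E {..<r}"
  define K where "K = s * card C"
  define k where "k = K * T"
  \<comment> \<open>\<open>K\<close> blocks of \<open>2 * T + 1\<close> positions, of which each set
    \<open>X\<close> built below uses only \<open>T\<close> per block; the slack leaves room for the
    shifts.\<close>
  define h where "h = K * (2 * T + 1)"
  have C: "finite C" "C \<noteq> {}" using r by (auto simp: C_def finite_PiE PiE_eq_empty_iff lessThan_empty_iff bot_nat_def)
  obtain M where M: "\<And>f. f \<in> nsets {..<M::nat} k \<rightarrow> ({..<k} \<rightarrow>\<^sub>E {..<r}) \<Longrightarrow>
      \<exists>H\<in>nsets {..<M} h. \<exists>c\<in>{..<k} \<rightarrow>\<^sub>E {..<r}. \<forall>X\<in>nsets H k. f X = c"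
    using ramsey_nsets_finite_colours[of "{..<k} \<rightarrow>\<^sub>E {..<r}" k h] by (auto simp: finite_PiE)
  show ?thesis
  proof (intro exI[of _ M] allI impI)
    fix \<chi> :: "nat \<Rightarrow> (nat \<Rightarrow> nat) \<Rightarrow> nat"
    assume \<chi>: "\<forall>a f. \<chi> a f < r"
    define code where "code X = (\<lambda>x\<in>{..<M}. if x \<in> X then card {y\<in>X. y < x} mod T else T)" for X
    define vec where "vec X = (\<lambda>l\<in>{..<k}. \<chi> (sorted_list_of_set X ! l) (code X))" for X
    have code: "code X \<in> {..<M} \<rightarrow>\<^sub>E {..T}" for X
      using T by (auto simp: code_def less_imp_le)
    obtain H c where H: "H \<in> nsets {..<M} h" and c: "c \<in> {..<k} \<rightarrow>\<^sub>E {..<r}"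
        and hom: "\<And>X. X \<in> nsets H k \<Longrightarrow> vec X = c"
      using M[of vec] \<chi> by (auto simp: vec_def)
    have finH: "finite H" and cardH: "card H = h" and HM: "H \<subseteq> {..<M}"
      using H by (auto simp: nsets_def)
    define p where "p l = sorted_list_of_set H ! l" for l
    have p_mono: "p l < p l'" if "l < l'" "l' < h" for l l'
      using that cardH strict_sorted_list_of_set[of H] sorted_wrt_nth_less
      unfolding p_def by (metis sorted_list_of_set.length_sorted_key_list_of_set)
    have p_in: "p l \<in> H" if "l < h" for l
      using that cardH finH unfolding p_def by (metis nth_mem sorted_list_of_set.length_sorted_key_list_of_set set_sorted_list_of_set)
    have p_inj: "l = l'" if "p l = p l'" "l < h" "l' < h" for l l'
      using that p_mono by (metis less_irrefl nat_neq_iff)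
    define block where "block j = (\<lambda>t\<in>{..<T}. c (j * T + t))" for j
    have slot: "j * T + t < k" if "j < K" "t < T" for j t
    proof -
      have "j * T + t < Suc j * T" using that by simp
      also have "\<dots> \<le> K * T" using that by (intro mult_right_mono) auto
      finally show ?thesis by (simp add: k_def)
    qed
    have "block \<in> {..<s * card C} \<rightarrow> C"
      using c slot by (auto simp: block_def C_def K_def)
    then obtain \<gamma> where "s \<le> card {j\<in>{..<K}. block j = \<gamma>}"
      using pigeonhole_fibre[OF C, of block s] unfolding K_def by blast
    then have "card {..<s} \<le> card {j\<in>{..<K}. block j = \<gamma>}" by simp
    then obtain b where b: "inj_on b {..<s}" "b ` {..<s} \<subseteq> {j\<in>{..<K}. block j = \<gamma>}"
      using card_le_inj[of "{..<s}" "{j\<in>{..<K}. block j = \<gamma>}"] by auto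
    have bK: "b a < K" "block (b a) = \<gamma>" if "a < s" for a using b(2) that by auto
    define ctr where "ctr j = j * (2 * T + 1) + T" for j
    have pos: "j * (2 * T + 1) + x < h" if "j < K" "x < 2 * T + 1" for j x
    proof -
      have "j * (2 * T + 1) + x < Suc j * (2 * T + 1)" using that by simp
      also have "\<dots> \<le> K * (2 * T + 1)" using that by (intro mult_right_mono) auto
      finally show ?thesis by (simp add: h_def)
    qed
    have quot: "(d * m + x) div m = d" "(d * m + x) mod m = x" if "x < m" for d m x :: nat
      using that by simp_all
    have ctr_div: "ctr j div (2 * T + 1) = j" for j
      unfolding ctr_def by (subst div_mult_self3) simp_all
    have ctr_h: "ctr j < h" if "j < K" for j using pos[OF that] by (simp add: ctr_def)
    define \<alpha> where "\<alpha> a = p (ctr (b a))" for a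
    have \<alpha>_inj: "inj_on \<alpha> {..<s}"
    proof (rule inj_onI)
      fix a a' assume a: "a \<in> {..<s}" "a' \<in> {..<s}" "\<alpha> a = \<alpha> a'"
      then have "ctr (b a) = ctr (b a')" unfolding \<alpha>_def using p_inj ctr_h bK by auto
      then have "b a = b a'" by (metis ctr_div)
      then show "a = a'" using b(1) a by (auto simp: inj_on_def)
    qed
    have \<alpha>_M: "\<alpha> ` {..<s} \<subseteq> {..<M}"
      using p_in[OF ctr_h[OF bK(1)]] HM by (auto simp: \<alpha>_def)
    have realise: "\<exists>f\<in>{..<M} \<rightarrow>\<^sub>E {..T}.
         \<forall>a<s. f (\<alpha> a) = g a \<and> (g a < T \<longrightarrow> \<chi> (\<alpha> a) f = \<gamma> (g a))"
      if g: "\<forall>a<s. g a \<le> T" for g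
    proof -
      \<comment> \<open>Blocks not selected by \<open>b\<close> get the inert value
        \<open>T\<close>.\<close>
      define G where "G j = (if j \<in> b ` {..<s} then g (inv_into {..<s} b j) else T)" for j
      have GT: "G j \<le> T" for j
        using g by (auto simp: G_def) (metis b(1) inv_into_f_f lessThan_iff)
      have Gb: "G (b a) = g a" if "a < s" for a using that b(1) by (simp add: G_def)
      \<comment> \<open>The point of residue \<open>t\<close> in a block goes to slot
        \<open>T + t - G\<close>. The central slot \<open>T\<close> is hit exactly by
        \<open>t = G\<close>, and by no point when \<open>G = T\<close>, as \<open>t < T\<close>;
        either way the code takes the value \<open>G\<close> at the centre.\<close>
      define off where "off l = T + l mod T - G (l div T)" for l
      define \<phi> where "\<phi> l = (l div T) * (2 * T + 1) + off l" for l
      have off: "off l < 2 * T + 1" for l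
        using T mod_less_divisor[of T l] unfolding off_def by linarith
      have \<phi>_div: "\<phi> l div (2 * T + 1) = l div T" "\<phi> l mod (2 * T + 1) = off l" for l
        unfolding \<phi>_def using off[of l] by (simp_all only: quot)
      have div_K: "l div T < K" if "l < k" for l
        using that unfolding k_def by (simp add: less_mult_imp_div_less)
      have \<phi>_h: "\<phi> l < h" if "l < k" for l
        unfolding \<phi>_def by (rule pos[OF div_K[OF that] off])
      have \<phi>_mono: "\<phi> l < \<phi> l'" if "l < l'" for l l'
      proof (cases "l div T = l' div T")
        case True
        then have "l mod T < l' mod T" using that
          by (metis add_less_cancel_left div_mult_mod_eq)
        then show ?thesis using True GT[of "l' div T"] by (simp add: \<phi>_def off_def)
      next
        case False
        then have "l div T < l' div T" using that by (simp add: div_le_mono le_neq_implies_less)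
        then have "\<phi> l div (2 * T + 1) < \<phi> l' div (2 * T + 1)" by (simp only: \<phi>_div)
        then show ?thesis by (meson div_le_mono leD leI)
      qed
      define \<xi> where "\<xi> l = p (\<phi> l)" for l
      have \<xi>: "strict_mono_on {..<k} \<xi>"
        using \<phi>_mono \<phi>_h p_mono by (auto simp: strict_mono_on_def \<xi>_def)
      define X where "X = \<xi> ` {..<k}"
      have "X \<subseteq> H" using p_in \<phi>_h by (auto simp: X_def \<xi>_def)
      moreover have "card X = k"
        unfolding X_def using strict_mono_on_imp_inj_on[OF \<xi>] by (simp add: card_image)
      ultimately have vecX: "vec X = c" using finH by (intro hom) (auto simp: nsets_def X_def)
      have "code X (\<alpha> a) = g a \<and> (g a < T \<longrightarrow> \<chi> (\<alpha> a) (code X) = \<gamma> (g a))" if a: "a < s" for a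
      proof (cases "g a < T")
        case True
        define l where "l = b a * T + g a"
        have l: "l div T = b a" "l mod T = g a" "l < k"
          using True slot[OF bK(1)[OF a] True] by (auto simp: l_def)
        have "\<phi> l = ctr (b a)" using l Gb[OF a] by (simp add: \<phi>_def off_def ctr_def)
        then have \<alpha>: "\<alpha> a = \<xi> l" by (simp add: \<alpha>_def \<xi>_def)
        then have mem: "\<alpha> a \<in> X" "\<alpha> a < M"
          using l(3) p_in[OF ctr_h[OF bK(1)[OF a]]] HM by (auto simp: X_def \<alpha>_def)
        have "card {y\<in>X. y < \<alpha> a} = l"
          unfolding X_def \<alpha> by (rule card_below_strict_mono_image[OF \<xi> l(3)])
        then have 1: "code X (\<alpha> a) = g a" using mem l(2) by (simp add: code_def)
        have "sorted_list_of_set X ! l = \<alpha> a"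
          unfolding X_def \<alpha> using sorted_list_of_strict_mono_image[OF \<xi>] l(3) by simp
        then have "\<chi> (\<alpha> a) (code X) = vec X l" using l(3) by (simp add: vec_def)
        also have "\<dots> = block (b a) (g a)" using True by (simp add: vecX block_def l_def)
        finally show ?thesis using 1 bK(2)[OF a] by simp
      next
        case False
        then have gT: "g a = T" using g a by (meson le_neq_implies_less)
        have "\<alpha> a \<notin> X"
        proof
          assume "\<alpha> a \<in> X"
          then obtain l where l: "l < k" "p (\<phi> l) = p (ctr (b a))"
            by (auto simp: X_def \<xi>_def \<alpha>_def)
          then have e: "\<phi> l = ctr (b a)" using p_inj \<phi>_h ctr_h bK(1)[OF a] by blast
          have "l div T = b a" "off l = T"
            using \<phi>_div[of l] quot[of T "2 * T + 1" "b a"] unfolding e ctr_def by simp_all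
          then show False using Gb[OF a] gT T mod_less_divisor[of T l] by (simp add: off_def)
        qed
        then show ?thesis
          using False gT p_in[OF ctr_h[OF bK(1)[OF a]]] HM by (auto simp: code_def \<alpha>_def)
      qed
      then show ?thesis using code by blast
    qed
    show "\<exists>\<alpha> \<gamma>. inj_on \<alpha> {..<s} \<and> \<alpha> ` {..<s} \<subseteq> {..<M} \<and>
      (\<forall>g. (\<forall>a<s. g a \<le> T) \<longrightarrow> (\<exists>f\<in>{..<M} \<rightarrow>\<^sub>E {..T}.
         \<forall>a<s. f (\<alpha> a) = g a \<and> (g a < T \<longrightarrow> \<chi> (\<alpha> a) f = \<gamma> (g a))))"
      by (rule exI[of _ \<alpha>], rule exI[of _ \<gamma>], rule conjI[OF \<alpha>_inj], rule conjI[OF \<alpha>_M], rule allI, rule impI, rule realise)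
  qed
qed

text \<open>In the universal statement the points and \<open>\<gamma>\<close> are fixed before the
  prescribed values \<open>g\<close>, so one choice of points serves every \<open>b \<in> B\<close>:
  each \<open>b\<close> is realised by its own function, with the values \<open>\<tau> a b\<close>
  prescribed.\<close>

lemma typed_bipartite_ramsey:
  fixes \<tau> :: "'a \<Rightarrow> 'b \<Rightarrow> nat"
  assumes fin: "finite A" "finite B" and T: "T \<ge> 1" and r: "r \<ge> 1"
    and \<tau>: "\<And>a b. a \<in> A \<Longrightarrow> b \<in> B \<Longrightarrow> \<tau> a b \<le> T"
  shows "\<exists>M. \<forall>\<chi> :: nat \<Rightarrow> (nat \<Rightarrow> nat) \<Rightarrow> nat. (\<forall>a f. \<chi> a f < r) \<longrightarrow>
    (\<exists>\<alpha> \<beta> \<gamma>. \<alpha> \<in> A \<rightarrow>\<^sub>E {..<M} \<and> inj_on \<alpha> A \<and> \<beta> \<in> B \<rightarrow>\<^sub>E ({..<M} \<rightarrow>\<^sub>E {..T}) \<and> inj_on \<beta> B \<and>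
      (\<forall>a\<in>A. \<forall>b\<in>B. \<beta> b (\<alpha> a) = \<tau> a b \<and> (\<tau> a b < T \<longrightarrow> \<chi> (\<alpha> a) (\<beta> b) = \<gamma> (\<tau> a b))))"
proof -
  obtain eA where eA: "bij_betw eA A {0..<card A}" using fin ex_bij_betw_finite_nat by blast
  obtain eB where eB: "bij_betw eB B {0..<card B}" using fin ex_bij_betw_finite_nat by blast
  define s where "s = card A + card B"
  obtain M where M: "\<And>\<chi> :: nat \<Rightarrow> (nat \<Rightarrow> nat) \<Rightarrow> nat. (\<forall>a f. \<chi> a f < r) \<Longrightarrow>
    (\<exists>\<alpha> \<gamma>. inj_on \<alpha> {..<s} \<and> \<alpha> ` {..<s} \<subseteq> {..<M} \<and>
      (\<forall>g. (\<forall>a<s. g a \<le> T) \<longrightarrow> (\<exists>f\<in>{..<M} \<rightarrow>\<^sub>E {..T}.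
         \<forall>a<s. f (\<alpha> a) = g a \<and> (g a < T \<longrightarrow> \<chi> (\<alpha> a) f = \<gamma> (g a)))))"
    using typed_bipartite_universal[OF T r, of s] by blast
  have eA_less: "eA a < card A" if "a \<in> A" for a using eA that by (fastforce simp: bij_betw_def)
  have eB_less: "eB b < card B" if "b \<in> B" for b using eB that by (fastforce simp: bij_betw_def)
  show ?thesis
  proof (intro exI[of _ M] allI impI)
    fix \<chi> :: "nat \<Rightarrow> (nat \<Rightarrow> nat) \<Rightarrow> nat"
    assume \<chi>: "\<forall>a f. \<chi> a f < r"
    obtain \<alpha>0 \<gamma> where \<alpha>0: "inj_on \<alpha>0 {..<s}" "\<alpha>0 ` {..<s} \<subseteq> {..<M}"
      and ext: "\<And>g. \<forall>a<s. g a \<le> T \<Longrightarrow> \<exists>f\<in>{..<M} \<rightarrow>\<^sub>E {..T}.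
         \<forall>a<s. f (\<alpha>0 a) = g a \<and> (g a < T \<longrightarrow> \<chi> (\<alpha>0 a) f = \<gamma> (g a))"
      using M[OF \<chi>] by (elim exE conjE) blast
    \<comment> \<open>The extra points \<open>card A + eB b\<close> tell the elements of \<open>B\<close> apart.\<close>
    define g where "g b i = (if i < card A then \<tau> (inv_into A eA i) b
        else if i = card A + eB b then 0 else T)" for b i
    have "\<exists>f\<in>{..<M} \<rightarrow>\<^sub>E {..T}. \<forall>a<s. f (\<alpha>0 a) = g b a \<and> (g b a < T \<longrightarrow> \<chi> (\<alpha>0 a) f = \<gamma> (g b a))"
      if "b \<in> B" for b
    proof (rule ext, intro allI impI)
      fix a
      have "inv_into A eA a \<in> A" if "a < card A"
        using eA that by (metis atLeast0LessThan bij_betw_imp_surj_on inv_into_into lessThan_iff)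
      then show "g b a \<le> T" using \<tau> \<open>b \<in> B\<close> by (simp add: g_def)
    qed
    then obtain f where f: "\<And>b. b \<in> B \<Longrightarrow> f b \<in> {..<M} \<rightarrow>\<^sub>E {..T}"
        "\<And>b a. b \<in> B \<Longrightarrow> a < s \<Longrightarrow> f b (\<alpha>0 a) = g b a"
        "\<And>b a. b \<in> B \<Longrightarrow> a < s \<Longrightarrow> g b a < T \<Longrightarrow> \<chi> (\<alpha>0 a) (f b) = \<gamma> (g b a)"
      by metis
    define \<alpha> where "\<alpha> = (\<lambda>a\<in>A. \<alpha>0 (eA a))"
    define \<beta> where "\<beta> = restrict f B"
    have g: "g b (eA a) = \<tau> a b" if "a \<in> A" for a b
      using that eA eA_less[OF that] by (auto simp: g_def bij_betw_def)
    have sA: "eA a < s" if "a \<in> A" for a using eA_less[OF that] by (simp add: s_def)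
    have "\<alpha> \<in> A \<rightarrow>\<^sub>E {..<M}" using \<alpha>0(2) sA by (auto simp: \<alpha>_def)
    moreover have "inj_on \<alpha> A"
      using \<alpha>0(1) eA sA by (auto simp: \<alpha>_def inj_on_def bij_betw_def)
    moreover have "\<beta> \<in> B \<rightarrow>\<^sub>E ({..<M} \<rightarrow>\<^sub>E {..T})" using f(1) by (simp add: \<beta>_def)
    moreover have "inj_on \<beta> B"
    proof (rule inj_onI)
      fix b b' assume b: "b \<in> B" "b' \<in> B" "\<beta> b = \<beta> b'"
      have "card A + eB b < s" using eB_less[OF b(1)] by (simp add: s_def)
      then have "g b (card A + eB b) = g b' (card A + eB b)"
        using f(2) b by (metis \<beta>_def restrict_apply')
      then have "eB b = eB b'" using T by (auto simp: g_def split: if_splits)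
      then show "b = b'" using eB b by (auto simp: bij_betw_def inj_on_def)
    qed
    moreover have "\<forall>a\<in>A. \<forall>b\<in>B. \<beta> b (\<alpha> a) = \<tau> a b \<and> (\<tau> a b < T \<longrightarrow> \<chi> (\<alpha> a) (\<beta> b) = \<gamma> (\<tau> a b))"
      using f(2,3) sA g by (simp add: \<alpha>_def \<beta>_def)
    ultimately show "\<exists>\<alpha> \<beta> \<gamma>. \<alpha> \<in> A \<rightarrow>\<^sub>E {..<M} \<and> inj_on \<alpha> A \<and> \<beta> \<in> B \<rightarrow>\<^sub>E ({..<M} \<rightarrow>\<^sub>E {..T}) \<and> inj_on \<beta> B \<and>
      (\<forall>a\<in>A. \<forall>b\<in>B. \<beta> b (\<alpha> a) = \<tau> a b \<and> (\<tau> a b < T \<longrightarrow> \<chi> (\<alpha> a) (\<beta> b) = \<gamma> (\<tau> a b)))"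
      by (intro exI[of _ \<alpha>] exI[of _ \<beta>] exI[of _ \<gamma>]) blast
  qed
qed

section \<open>The partite construction\<close>

text \<open>A typed graph has a type \<open>ty x y < T\<close> on every edge; \<open>ty x y = T\<close> means that \<open>x\<close> and \<open>y\<close>
  are not adjacent.\<close>

definition typed_graph :: "nat \<Rightarrow> 'v set \<Rightarrow> ('v \<Rightarrow> 'v \<Rightarrow> nat) \<Rightarrow> bool" where
  "typed_graph T V ty \<longleftrightarrow> finite V \<and> (\<forall>x\<in>V. \<forall>y\<in>V. ty x y \<le> T \<and> ty x y = ty y x) \<and>
     (\<forall>x\<in>V. \<forall>y\<in>V. \<forall>z\<in>V. \<forall>t<T. \<not> (ty x y = t \<and> ty y z = t \<and> ty x z = t))"

definition partite :: "nat \<Rightarrow> 'v set \<Rightarrow> ('v \<Rightarrow> 'v \<Rightarrow> nat) \<Rightarrow> ('v \<Rightarrow> nat) \<Rightarrow> bool" where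
  "partite T V ty \<pi> \<longleftrightarrow> (\<forall>x\<in>V. \<forall>y\<in>V. ty x y < T \<longrightarrow> \<pi> x \<noteq> \<pi> y)"

text \<open>Total on all pairs, so that colourings pull back along arbitrary maps.\<close>

definition colouring :: "nat \<Rightarrow> ('v \<Rightarrow> 'v \<Rightarrow> nat) \<Rightarrow> bool" where
  "colouring r \<chi> \<longleftrightarrow> (\<forall>x y. \<chi> x y < r \<and> \<chi> x y = \<chi> y x)"

definition typed_hom :: "nat \<Rightarrow> 'v set \<Rightarrow> ('v \<Rightarrow> 'v \<Rightarrow> nat) \<Rightarrow> 'w set \<Rightarrow> ('w \<Rightarrow> 'w \<Rightarrow> nat) \<Rightarrow> ('v \<Rightarrow> 'w) \<Rightarrow> bool"
  where "typed_hom T V ty V' ty' h \<longleftrightarrow> h \<in> V \<rightarrow> V' \<and>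
     (\<forall>x\<in>V. \<forall>y\<in>V. ty x y < T \<longrightarrow> ty' (h x) (h y) = ty x y)"

text \<open>\<open>D\<close> holds the ordered pairs of classes between which the colour depends on
  class pair and type only; the construction enlarges \<open>D\<close> one pair at a time. The
  homomorphism has to respect the classes so that pairs dealt with earlier keep their
  meaning.\<close>

definition partite_arrow ::
  "nat \<Rightarrow> nat \<Rightarrow> (nat \<times> nat) set \<Rightarrow> 'v set \<Rightarrow> ('v \<Rightarrow> 'v \<Rightarrow> nat) \<Rightarrow> ('v \<Rightarrow> nat) \<Rightarrow>
    'w set \<Rightarrow> ('w \<Rightarrow> 'w \<Rightarrow> nat) \<Rightarrow> ('w \<Rightarrow> nat) \<Rightarrow> bool"
  where "partite_arrow T r D V ty \<pi> V' ty' \<pi>' \<longleftrightarrow> typed_graph T V' ty' \<and> partite T V' ty' \<pi>' \<and>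
    (\<forall>\<chi>. colouring r \<chi> \<longrightarrow> (\<exists>h \<gamma>. typed_hom T V ty V' ty' h \<and> (\<forall>x\<in>V. \<pi>' (h x) = \<pi> x) \<and>
       (\<forall>x\<in>V. \<forall>y\<in>V. (\<pi> x, \<pi> y) \<in> D \<longrightarrow> ty x y < T \<longrightarrow>
          \<chi> (h x) (h y) = \<gamma> (\<pi> x, \<pi> y) (ty x y))))"

lemma typed_graph_loopless:
  assumes "typed_graph T V ty" "x \<in> V"
  shows "ty x x = T"
proof (rule ccontr)
  assume "ty x x \<noteq> T"
  then have "ty x x < T" using assms by (simp add: typed_graph_def le_neq_implies_less)
  then show False using assms unfolding typed_graph_def by blast
qed

lemma partite_arrowD:
  assumes "partite_arrow T r D V ty \<pi> V' ty' \<pi>'"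
  shows "typed_graph T V' ty'" "partite T V' ty' \<pi>'"
  by (rule conjunct1[OF assms[unfolded partite_arrow_def]],
      rule conjunct1[OF conjunct2[OF assms[unfolded partite_arrow_def]]])

lemma partite_arrow_colouringE:
  assumes "partite_arrow T r D V ty \<pi> V' ty' \<pi>'" "colouring r \<chi>"
  obtains h \<gamma> where "typed_hom T V ty V' ty' h" "\<And>x. x \<in> V \<Longrightarrow> \<pi>' (h x) = \<pi> x"
    "\<And>x y. \<lbrakk>x \<in> V; y \<in> V; (\<pi> x, \<pi> y) \<in> D; ty x y < T\<rbrakk> \<Longrightarrow> \<chi> (h x) (h y) = \<gamma> (\<pi> x, \<pi> y) (ty x y)"
proof -
  have "\<exists>h \<gamma>. typed_hom T V ty V' ty' h \<and> (\<forall>x\<in>V. \<pi>' (h x) = \<pi> x) \<and>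
       (\<forall>x\<in>V. \<forall>y\<in>V. (\<pi> x, \<pi> y) \<in> D \<longrightarrow> ty x y < T \<longrightarrow>
          \<chi> (h x) (h y) = \<gamma> (\<pi> x, \<pi> y) (ty x y))"
    using assms by (simp only: partite_arrow_def)
  then show thesis using that by (elim exE conjE) (simp only: Ball_def)
qed

text \<open>Each amalgamation produces vertices of a more complicated type; renaming them as
  naturals lets the induction on \<open>D\<close> stay at a single type.\<close>

lemma partite_arrow_transport:
  fixes V' :: "'w set"
  assumes "partite_arrow T r D V ty \<pi> V' ty' \<pi>'"
  shows "\<exists>(V'' :: nat set) ty'' \<pi>''. partite_arrow T r D V ty \<pi> V'' ty'' \<pi>''"
proof -
  note V' = partite_arrowD[OF assms]
  have "finite V'" using V' by (simp add: typed_graph_def)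
  then obtain f :: "'w \<Rightarrow> nat" where f: "inj_on f V'"
    using finite_imp_inj_to_nat_seg[OF \<open>finite V'\<close>] by (elim exE conjE)
  define k where "k = inv_into V' f"
  have kf [simp]: "k (f x) = x" if "x \<in> V'" for x using f that by (simp add: k_def)
  define ty'' where "ty'' u w = ty' (k u) (k w)" for u w
  have "typed_graph T (f ` V') ty''"
    using V'(1) unfolding typed_graph_def ty''_def by auto
  moreover have "partite T (f ` V') ty'' (\<pi>' \<circ> k)"
    using V'(2) unfolding partite_def ty''_def by auto
  moreover have "\<exists>h \<gamma>. typed_hom T V ty (f ` V') ty'' h \<and> (\<forall>x\<in>V. (\<pi>' \<circ> k) (h x) = \<pi> x) \<and>
       (\<forall>x\<in>V. \<forall>y\<in>V. (\<pi> x, \<pi> y) \<in> D \<longrightarrow> ty x y < T \<longrightarrow>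
          \<chi> (h x) (h y) = \<gamma> (\<pi> x, \<pi> y) (ty x y))" if "colouring r \<chi>" for \<chi>
  proof -
    have "colouring r (\<lambda>x y. \<chi> (f x) (f y))" using that by (simp add: colouring_def)
    then obtain h \<gamma> where h: "typed_hom T V ty V' ty' h" "\<And>x. x \<in> V \<Longrightarrow> \<pi>' (h x) = \<pi> x"
       "\<And>x y. \<lbrakk>x \<in> V; y \<in> V; (\<pi> x, \<pi> y) \<in> D; ty x y < T\<rbrakk> \<Longrightarrow>
          \<chi> (f (h x)) (f (h y)) = \<gamma> (\<pi> x, \<pi> y) (ty x y)"
      by (rule partite_arrow_colouringE[OF assms]) blast
    have hV: "h x \<in> V'" if "x \<in> V" for x using h(1) that by (auto simp: typed_hom_def)
    show ?thesis
      using h hV by (intro exI[of _ "f \<circ> h"] exI[of _ \<gamma>]) (auto simp: typed_hom_def ty''_def)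
  qed
  ultimately show ?thesis unfolding partite_arrow_def by blast
qed

text \<open>Amalgamation of copies of \<open>V\<close> along the classes \<open>i\<close> and \<open>j\<close>: a copy is given by an embedding
  \<open>(\<alpha>, \<beta>)\<close> of these two classes into the bipartite typed graph of \<open>typed_bipartite_ramsey\<close>,
  and all its other vertices are its own. A triangle of one type has a vertex outside both
  classes, hence lies in a single copy.\<close>

lemma partite_arrow_pair:
  fixes V :: "'v set"
  assumes tg: "typed_graph T V ty" and part: "partite T V ty \<pi>"
    and T: "T \<ge> 1" and r: "r \<ge> 1" and ij: "i \<noteq> j"
  shows "\<exists>(V' :: nat set) ty' \<pi>'. partite_arrow T r {(i, j)} V ty \<pi> V' ty' \<pi>'"
proof -
  define A where "A = {x\<in>V. \<pi> x = i}"
  define B where "B = {x\<in>V. \<pi> x = j}"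
  have finV: "finite V" using tg by (simp add: typed_graph_def)
  have fin: "finite A" "finite B" using finV by (auto simp: A_def B_def)
  have ty_le: "ty x y \<le> T" and ty_sym: "ty x y = ty y x" if "x \<in> V" "y \<in> V" for x y
    using tg that by (auto simp: typed_graph_def)
  have tri: "\<not> (ty x y = t \<and> ty y z = t \<and> ty x z = t)" if "x \<in> V" "y \<in> V" "z \<in> V" "t < T" for x y z t
    using tg that unfolding typed_graph_def by blast
  have same: "ty x y = T" if "x \<in> V" "y \<in> V" "\<pi> x = \<pi> y" for x y
    using part ty_le that unfolding partite_def by (metis le_neq_implies_less)
  have "\<exists>M. \<forall>\<chi> :: nat \<Rightarrow> (nat \<Rightarrow> nat) \<Rightarrow> nat. (\<forall>a f. \<chi> a f < r) \<longrightarrow>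
    (\<exists>\<alpha> \<beta> \<gamma>. \<alpha> \<in> A \<rightarrow>\<^sub>E {..<M} \<and> inj_on \<alpha> A \<and> \<beta> \<in> B \<rightarrow>\<^sub>E ({..<M} \<rightarrow>\<^sub>E {..T}) \<and> inj_on \<beta> B \<and>
      (\<forall>a\<in>A. \<forall>b\<in>B. \<beta> b (\<alpha> a) = ty a b \<and> (ty a b < T \<longrightarrow> \<chi> (\<alpha> a) (\<beta> b) = \<gamma> (ty a b))))"
    using ty_le by (intro typed_bipartite_ramsey[OF fin T r]) (auto simp: A_def B_def)
  then obtain M where M: "\<And>\<chi> :: nat \<Rightarrow> (nat \<Rightarrow> nat) \<Rightarrow> nat. \<forall>a f. \<chi> a f < r \<Longrightarrow>
    \<exists>\<alpha> \<beta> \<gamma>. \<alpha> \<in> A \<rightarrow>\<^sub>E {..<M} \<and> inj_on \<alpha> A \<and> \<beta> \<in> B \<rightarrow>\<^sub>E ({..<M} \<rightarrow>\<^sub>E {..T}) \<and> inj_on \<beta> B \<and>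
      (\<forall>a\<in>A. \<forall>b\<in>B. \<beta> b (\<alpha> a) = ty a b \<and> (ty a b < T \<longrightarrow> \<chi> (\<alpha> a) (\<beta> b) = \<gamma> (ty a b)))"
    by blast
  define Cs where "Cs = {(\<alpha>, \<beta>). \<alpha> \<in> A \<rightarrow>\<^sub>E {..<M} \<and> inj_on \<alpha> A \<and>
      \<beta> \<in> B \<rightarrow>\<^sub>E ({..<M} \<rightarrow>\<^sub>E {..T}) \<and> inj_on \<beta> B \<and> (\<forall>a\<in>A. \<forall>b\<in>B. \<beta> b (\<alpha> a) = ty a b)}"
  have "Cs \<subseteq> (A \<rightarrow>\<^sub>E {..<M}) \<times> (B \<rightarrow>\<^sub>E ({..<M} \<rightarrow>\<^sub>E {..T}))" by (auto simp: Cs_def)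
  then have finC: "finite Cs"
    using fin by (rule_tac finite_subset) (auto intro!: finite_PiE)
  define emb where "emb c x = (if \<pi> x = i then Inl (fst c x) else if \<pi> x = j then Inr (Inl (snd c x))
      else Inr (Inr (x, c)))" for c :: "('v \<Rightarrow> nat) \<times> ('v \<Rightarrow> nat \<Rightarrow> nat)" and x
  define \<pi>' where "\<pi>' u = (case u of Inl _ \<Rightarrow> i | Inr (Inl _) \<Rightarrow> j | Inr (Inr (x, c)) \<Rightarrow> \<pi> x)"
    for u :: "nat + (nat \<Rightarrow> nat) + 'v \<times> ('v \<Rightarrow> nat) \<times> ('v \<Rightarrow> nat \<Rightarrow> nat)"
  have \<pi>'_emb [simp]: "\<pi>' (emb c x) = \<pi> x" for c x by (simp add: \<pi>'_def emb_def)
  define V' where "V' = (\<Union>c\<in>Cs. emb c ` V)"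
  have priv: "c = c' \<and> x = x'" if "emb c x = emb c' x'" "\<pi> x \<noteq> i" "\<pi> x \<noteq> j" for c c' x x'
    using that by (auto simp: emb_def split: if_splits)
  have injC: "inj_on (fst c) A" "inj_on (snd c) B" if "c \<in> Cs" for c
    using that by (auto simp: Cs_def)
  have emb_inj: "x = x'" if "c \<in> Cs" "x \<in> V" "x' \<in> V" "emb c x = emb c x'" for c x x'
  proof -
    have "\<pi> x = \<pi> x'" using that(4) \<pi>'_emb by metis
    then show ?thesis
      using that(2-4) ij injC[OF that(1)]
      by (cases "\<pi> x = i"; cases "\<pi> x = j") (auto simp: emb_def A_def B_def dest: inj_onD)
  qed
  \<comment> \<open>Distinct copies overlap only in the shared classes, where the type of a pair is
    recovered from its images as \<open>\<beta> b (\<alpha> a)\<close>; hence types are well defined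
    on the union.\<close>
  have agree: "ty x y = ty x' y'"
    if "c \<in> Cs" "c' \<in> Cs" "x \<in> V" "y \<in> V" "x' \<in> V" "y' \<in> V"
      "emb c x = emb c' x'" "emb c y = emb c' y'" for c c' x x' y y'
  proof (cases "c = c'")
    case True
    then have "x = x'" "y = y'" using that emb_inj[OF that(1)] by blast+
    then show ?thesis by simp
  next
    case False
    have \<pi>eq: "\<pi> x = \<pi> x'" "\<pi> y = \<pi> y'" using that(7,8) \<pi>'_emb by metis+
    have pxy: "\<pi> x = i \<or> \<pi> x = j" "\<pi> y = i \<or> \<pi> y = j"
      using priv[OF that(7)] priv[OF that(8)] False by blast+
    have main: "ty u w = ty u' w'"
      if "u \<in> A" "w \<in> B" "u' \<in> A" "w' \<in> B" "emb c u = emb c' u'" "emb c w = emb c' w'" for u w u' w'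
    proof -
      have "fst c u = fst c' u'" "snd c w = snd c' w'"
        using that ij by (auto simp: emb_def A_def B_def)
      moreover have "snd c w (fst c u) = ty u w" "snd c' w' (fst c' u') = ty u' w'"
        using that \<open>c \<in> Cs\<close> \<open>c' \<in> Cs\<close> by (auto simp: Cs_def)
      ultimately show ?thesis by simp
    qed
    show ?thesis
    proof (cases "\<pi> x = \<pi> y")
      case True
      then show ?thesis using same that \<pi>eq by simp
    next
      case neq: False
      then consider "\<pi> x = i" "\<pi> y = j" | "\<pi> x = j" "\<pi> y = i" using pxy by auto
      then show ?thesis
      proof cases
        case 1
        then show ?thesis using main[of x y x' y'] that \<pi>eq by (simp add: A_def B_def)
      next
        case 2
        then have "ty y x = ty y' x'" using main[of y x y' x'] that \<pi>eq by (simp add: A_def B_def)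
        then show ?thesis using ty_sym that by simp
      qed
    qed
  qed
  define cov where "cov u w c x y \<longleftrightarrow> c \<in> Cs \<and> x \<in> V \<and> y \<in> V \<and> u = emb c x \<and> w = emb c y" for u w c x y
  define ty' where "ty' u w = (if \<exists>c x y. cov u w c x y then
      (SOME t. \<exists>c x y. cov u w c x y \<and> t = ty x y) else T)" for u w
  have ty'_emb: "ty' u w = ty x y" if "cov u w c x y" for u w c x y
  proof -
    have "\<exists>t. \<exists>c x y. cov u w c x y \<and> t = ty x y" using that by blast
    from someI_ex[OF this] obtain c' x' y'
      where c': "cov u w c' x' y'" "(SOME t. \<exists>c x y. cov u w c x y \<and> t = ty x y) = ty x' y'"
      by auto
    have "ty x y = ty x' y'" using that c'(1) agree[of c c' x y x' y'] unfolding cov_def by auto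
    moreover have "\<exists>c x y. cov u w c x y" using that by blast
    ultimately show ?thesis using c'(2) unfolding ty'_def by (simp only: if_True)
  qed
  have covered: "\<exists>c x y. cov u w c x y" if "ty' u w < T" for u w
    using that by (auto simp: ty'_def split: if_splits)
  have "typed_graph T V' ty'"
    unfolding typed_graph_def
  proof (intro conjI ballI allI impI notI)
    show "finite V'" using finC finV by (simp add: V'_def)
    fix u w assume "u \<in> V'" "w \<in> V'"
    show "ty' u w \<le> T"
    proof (cases "\<exists>c x y. cov u w c x y")
      case True
      then obtain c x y where c: "cov u w c x y" by blast
      then show ?thesis using ty'_emb[OF c] ty_le unfolding cov_def by simp
    qed (simp only: ty'_def if_False order.refl)
    have comm: "cov u w c x y \<longleftrightarrow> cov w u c y x" for c x y by (auto simp: cov_def)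
    show "ty' u w = ty' w u"
    proof (cases "\<exists>c x y. cov u w c x y")
      case True
      then obtain c x y where c: "cov u w c x y" by blast
      have "ty' w u = ty y x" by (rule ty'_emb) (use c comm in blast)
      then show ?thesis using ty'_emb[OF c] ty_sym c unfolding cov_def by simp
    next
      case False
      then have "\<not> (\<exists>c x y. cov w u c x y)" using comm by blast
      then show ?thesis using False by (simp only: ty'_def if_False)
    qed
  next
    fix u w z t
    assume t: "t < T" "ty' u w = t \<and> ty' w z = t \<and> ty' u z = t"
    obtain c1 x1 y1 where 1: "cov u w c1 x1 y1" using covered t by metis
    obtain c2 x2 y2 where 2: "cov w z c2 x2 y2" using covered t by metis
    obtain c3 x3 y3 where 3: "cov u z c3 x3 y3" using covered t by metis
    have types: "ty x1 y1 = t" "ty x2 y2 = t" "ty x3 y3 = t"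
      using t ty'_emb 1 2 3 by metis+
    have e: "emb c1 x1 = emb c3 x3" "emb c1 y1 = emb c2 x2" "emb c2 y2 = emb c3 y3"
      using 1 2 3 by (simp_all add: cov_def)
    have "\<pi> x1 = \<pi> x3" "\<pi> y1 = \<pi> x2" "\<pi> y2 = \<pi> y3"
      using e by (metis \<pi>'_emb)+
    moreover have "\<pi> x1 \<noteq> \<pi> y1" "\<pi> x2 \<noteq> \<pi> y2" "\<pi> x3 \<noteq> \<pi> y3"
      using types t(1) part 1 2 3 by (auto simp: cov_def partite_def)
    ultimately consider "\<pi> x1 \<noteq> i" "\<pi> x1 \<noteq> j" | "\<pi> y1 \<noteq> i" "\<pi> y1 \<noteq> j" | "\<pi> y2 \<noteq> i" "\<pi> y2 \<noteq> j"
      by metis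
    then have "c1 = c3 \<and> x1 = x3 \<or> c1 = c2 \<and> y1 = x2 \<or> c2 = c3 \<and> y2 = y3"
      by cases (use priv[OF e(1)] priv[OF e(2)] priv[OF e(3)] in blast)+
    then have "\<exists>c\<in>Cs. \<exists>x\<in>V. \<exists>y\<in>V. \<exists>v\<in>V. u = emb c x \<and> w = emb c y \<and> z = emb c v"
    proof (elim disjE conjE)
      assume "c1 = c3" "x1 = x3"
      then show ?thesis using 1 3 unfolding cov_def by blast
    next
      assume "c1 = c2" "y1 = x2"
      then show ?thesis using 1 2 unfolding cov_def by blast
    next
      assume "c2 = c3" "y2 = y3"
      then show ?thesis using 2 3 unfolding cov_def by blast
    qed
    then obtain c x y v where "c \<in> Cs" "x \<in> V" "y \<in> V" "v \<in> V" "u = emb c x" "w = emb c y" "z = emb c v"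
      by blast
    then have "cov u w c x y" "cov w z c y v" "cov u z c x v" by (simp_all add: cov_def)
    then have "ty x y = t" "ty y v = t" "ty x v = t"
      using t(2) ty'_emb by simp_all
    then show False using tri \<open>x \<in> V\<close> \<open>y \<in> V\<close> \<open>v \<in> V\<close> t(1) by blast
  qed
  moreover have "partite T V' ty' \<pi>'"
    unfolding partite_def
  proof (intro ballI impI)
    fix u w assume "ty' u w < T"
    then obtain c x y where c: "cov u w c x y" using covered by blast
    then have "ty x y < T" using ty'_emb \<open>ty' u w < T\<close> by metis
    then show "\<pi>' u \<noteq> \<pi>' w" using c part unfolding cov_def partite_def by auto
  qed
  moreover have "\<exists>h \<gamma>. typed_hom T V ty V' ty' h \<and> (\<forall>x\<in>V. \<pi>' (h x) = \<pi> x) \<and>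
       (\<forall>x\<in>V. \<forall>y\<in>V. (\<pi> x, \<pi> y) \<in> {(i, j)} \<longrightarrow> ty x y < T \<longrightarrow>
          \<chi> (h x) (h y) = \<gamma> (\<pi> x, \<pi> y) (ty x y))" if \<chi>: "colouring r \<chi>" for \<chi>
  proof -
    have "\<forall>a f. \<chi> (Inl a) (Inr (Inl f)) < r" using \<chi> by (simp add: colouring_def)
    from M[OF this] obtain \<alpha> \<beta> \<gamma> where "\<alpha> \<in> A \<rightarrow>\<^sub>E {..<M}" "inj_on \<alpha> A"
        "\<beta> \<in> B \<rightarrow>\<^sub>E ({..<M} \<rightarrow>\<^sub>E {..T})" "inj_on \<beta> B"
      and *: "\<forall>a\<in>A. \<forall>b\<in>B. \<beta> b (\<alpha> a) = ty a b \<and>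
        (ty a b < T \<longrightarrow> \<chi> (Inl (\<alpha> a)) (Inr (Inl (\<beta> b))) = \<gamma> (ty a b))"
      by (elim exE conjE)
    then have c: "(\<alpha>, \<beta>) \<in> Cs" by (simp add: Cs_def)
    have \<gamma>: "\<chi> (Inl (\<alpha> a)) (Inr (Inl (\<beta> b))) = \<gamma> (ty a b)" if "a \<in> A" "b \<in> B" "ty a b < T" for a b
      using * that by blast
    define h where "h = emb (\<alpha>, \<beta>)"
    have "typed_hom T V ty V' ty' h"
      unfolding typed_hom_def
    proof (intro conjI ballI impI)
      show "h \<in> V \<rightarrow> V'" using c by (auto simp: h_def V'_def)
      fix x y assume "x \<in> V" "y \<in> V"
      then have "cov (h x) (h y) (\<alpha>, \<beta>) x y" using c by (simp add: cov_def h_def)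
      then show "ty' (h x) (h y) = ty x y" by (rule ty'_emb)
    qed
    then show ?thesis
      using \<gamma> ij by (intro exI[of _ h] exI[of _ "\<lambda>_. \<gamma>"]) (simp add: h_def, simp add: emb_def A_def B_def)
  qed
  ultimately have "partite_arrow T r {(i, j)} V ty \<pi> V' ty' \<pi>'"
    unfolding partite_arrow_def by blast
  then show ?thesis by (rule partite_arrow_transport)
qed

text \<open>A colouring of the largest graph is first made uniform on \<open>p\<close>, then pulled
  back along the homomorphism obtained and made uniform on \<open>D\<close>. The composition keeps
  both properties because each homomorphism preserves classes and types.\<close>

lemma partite_arrow_insert:
  assumes 1: "partite_arrow T r D V ty \<pi> V' ty' \<pi>'" and 2: "partite_arrow T r {p} V' ty' \<pi>' V'' ty'' \<pi>''"
  shows "partite_arrow T r (insert p D) V ty \<pi> V'' ty'' \<pi>''"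
  unfolding partite_arrow_def
proof (intro conjI allI impI)
  show "typed_graph T V'' ty''" "partite T V'' ty'' \<pi>''" by (rule partite_arrowD[OF 2])+
  fix \<chi> :: "'c \<Rightarrow> 'c \<Rightarrow> nat" assume \<chi>: "colouring r \<chi>"
  then obtain h2 \<gamma>2 where h2: "typed_hom T V' ty' V'' ty'' h2" "\<And>x. x \<in> V' \<Longrightarrow> \<pi>'' (h2 x) = \<pi>' x"
     "\<And>x y. \<lbrakk>x \<in> V'; y \<in> V'; (\<pi>' x, \<pi>' y) \<in> {p}; ty' x y < T\<rbrakk> \<Longrightarrow>
        \<chi> (h2 x) (h2 y) = \<gamma>2 (\<pi>' x, \<pi>' y) (ty' x y)"
    by (rule partite_arrow_colouringE[OF 2]) blast
  have "colouring r (\<lambda>x y. \<chi> (h2 x) (h2 y))" using \<chi> by (simp add: colouring_def)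
  then obtain h1 \<gamma>1 where h1: "typed_hom T V ty V' ty' h1" "\<And>x. x \<in> V \<Longrightarrow> \<pi>' (h1 x) = \<pi> x"
     "\<And>x y. \<lbrakk>x \<in> V; y \<in> V; (\<pi> x, \<pi> y) \<in> D; ty x y < T\<rbrakk> \<Longrightarrow>
        \<chi> (h2 (h1 x)) (h2 (h1 y)) = \<gamma>1 (\<pi> x, \<pi> y) (ty x y)"
    by (rule partite_arrow_colouringE[OF 1]) blast
  have h1V: "h1 x \<in> V'" if "x \<in> V" for x using h1(1) that by (auto simp: typed_hom_def)
  have hom: "typed_hom T V ty V'' ty'' (h2 \<circ> h1)"
    using h1(1) h2(1) by (auto simp: typed_hom_def Pi_iff)
  define \<gamma> where "\<gamma> q = (if q = p then \<gamma>2 p else \<gamma>1 q)" for q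
  have "\<chi> (h2 (h1 x)) (h2 (h1 y)) = \<gamma> (\<pi> x, \<pi> y) (ty x y)"
    if "x \<in> V" "y \<in> V" "(\<pi> x, \<pi> y) \<in> insert p D" "ty x y < T" for x y
  proof (cases "(\<pi> x, \<pi> y) = p")
    case True
    have "ty' (h1 x) (h1 y) = ty x y" using h1(1) that by (simp add: typed_hom_def)
    then show ?thesis using h2(3) h1(2) h1V that True by (simp add: \<gamma>_def)
  next
    case False
    then show ?thesis using h1(3) that by (auto simp: \<gamma>_def)
  qed
  then show "\<exists>h \<gamma>. typed_hom T V ty V'' ty'' h \<and> (\<forall>x\<in>V. \<pi>'' (h x) = \<pi> x) \<and>
       (\<forall>x\<in>V. \<forall>y\<in>V. (\<pi> x, \<pi> y) \<in> insert p D \<longrightarrow> ty x y < T \<longrightarrow>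
          \<chi> (h x) (h y) = \<gamma> (\<pi> x, \<pi> y) (ty x y))"
    using hom h1(2) h1V h2(2) by (intro exI[of _ "h2 \<circ> h1"] exI[of _ \<gamma>]) simp
qed

lemma partite_arrow_exists:
  fixes V :: "'v set"
  assumes tg: "typed_graph T V ty" and part: "partite T V ty \<pi>"
    and T: "T \<ge> 1" and r: "r \<ge> 1" and D: "finite D" "\<And>i j. (i, j) \<in> D \<Longrightarrow> i \<noteq> j"
  shows "\<exists>(V' :: nat set) ty' \<pi>'. partite_arrow T r D V ty \<pi> V' ty' \<pi>'"
  using D
proof (induction D rule: finite_induct)
  case empty
  have "partite_arrow T r {} V ty \<pi> V ty \<pi>"
    using tg part unfolding partite_arrow_def
    by (auto intro!: exI[of _ "\<lambda>x. x"] simp: typed_hom_def)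
  then show ?case by (rule partite_arrow_transport)
next
  case (insert p D)
  then obtain V' :: "nat set" and ty' \<pi>' where 1: "partite_arrow T r D V ty \<pi> V' ty' \<pi>'" by blast
  obtain i j where p: "p = (i, j)" by (cases p)
  have "i \<noteq> j" using insert.prems p by blast
  then obtain V'' :: "nat set" and ty'' \<pi>'' where "partite_arrow T r {p} V' ty' \<pi>' V'' ty'' \<pi>''"
    using partite_arrow_pair[OF partite_arrowD[OF 1] T r] p by blast
  then show ?case using partite_arrow_insert[OF 1] by blast
qed

text \<open>The partite construction leaves a dependence on the pair of classes. It is therefore
  started from disjoint copies of \<open>V\<close>, one laid out on every \<open>p\<close>-subset of
  \<open>N\<close> classes; Ramsey's theorem for pairs of classes, coloured by their functions from
  types to colours, then selects a copy on which the pair no longer matters.\<close>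

theorem typed_ramsey:
  fixes V :: "'v set"
  assumes tg: "typed_graph T V ty" and T: "T \<ge> 1" and r: "r \<ge> 1"
  shows "\<exists>(V' :: nat set) ty'. typed_graph T V' ty' \<and> (\<forall>\<chi>. colouring r \<chi> \<longrightarrow>
    (\<exists>h \<gamma>. typed_hom T V ty V' ty' h \<and>
      (\<forall>x\<in>V. \<forall>y\<in>V. ty x y < T \<longrightarrow> \<chi> (h x) (h y) = \<gamma> (ty x y))))"
proof -
  define p where "p = card V"
  have finV: "finite V" using tg by (simp add: typed_graph_def)
  obtain idx where idx: "bij_betw idx V {0..<p}"
    using ex_bij_betw_finite_nat[OF finV] unfolding p_def by blast
  have idx_less: "idx x < p" if "x \<in> V" for x using bij_betwE[OF idx] that by auto
  have idx_neq: "idx x \<noteq> idx y" if "x \<in> V" "y \<in> V" "x \<noteq> y" for x y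
    using bij_betw_imp_inj_on[OF idx] that by (auto dest: inj_onD)
  define C where "C = {..<T} \<rightarrow>\<^sub>E {..<r}"
  have "finite C" by (simp add: C_def finite_PiE)
  then obtain N where N: "\<And>f. f \<in> nsets {..<N::nat} 2 \<rightarrow> C \<Longrightarrow>
      \<exists>S\<in>nsets {..<N} p. \<exists>c\<in>C. \<forall>X\<in>nsets S 2. f X = c"
    using ramsey_nsets_finite_colours[of C 2 p] by blast
  define V0 where "V0 = nsets {..<N} p \<times> V"
  define ty0 where "ty0 u w = (if fst u = fst w then ty (snd u) (snd w) else T)" for u w :: "nat set \<times> 'v"
  define \<pi> where "\<pi> u = sorted_list_of_set (fst u) ! idx (snd u)" for u :: "nat set \<times> 'v"
  have len: "length (sorted_list_of_set S) = p" if "S \<in> nsets {..<N} p" for S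
    using that by (simp add: nsets_def)
  have \<pi>_in: "\<pi> (S, x) \<in> S" if "S \<in> nsets {..<N} p" "x \<in> V" for S x
  proof -
    have "\<pi> (S, x) \<in> set (sorted_list_of_set S)"
      unfolding \<pi>_def using len[OF that(1)] idx_less[OF that(2)] by simp
    then show ?thesis using that(1) by (simp add: nsets_def)
  qed
  have \<pi>_neq: "\<pi> (S, x) \<noteq> \<pi> (S, y)" if "S \<in> nsets {..<N} p" "x \<in> V" "y \<in> V" "x \<noteq> y" for S x y
    unfolding \<pi>_def using len[OF that(1)] idx_less that idx_neq
    by (simp add: nth_eq_iff_index_eq)
  have adj_neq: "x \<noteq> y" if "x \<in> V" "y \<in> V" "ty x y < T" for x y
    using typed_graph_loopless[OF tg that(1)] that by auto
  have ty_sym: "ty x y = ty y x" if "x \<in> V" "y \<in> V" for x y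
    using tg that by (simp add: typed_graph_def)
  have "typed_graph T V0 ty0"
    unfolding typed_graph_def
  proof (intro conjI ballI allI impI notI)
    show "finite V0" using finV by (simp add: V0_def finite_imp_finite_nsets)
    fix u w assume "u \<in> V0" "w \<in> V0"
    then show "ty0 u w \<le> T" "ty0 u w = ty0 w u"
      using tg by (auto simp: V0_def ty0_def typed_graph_def)
  next
    fix u w z t
    assume uwz: "u \<in> V0" "w \<in> V0" "z \<in> V0" and t: "t < T" "ty0 u w = t \<and> ty0 w z = t \<and> ty0 u z = t"
    then have "ty (snd u) (snd w) = t \<and> ty (snd w) (snd z) = t \<and> ty (snd u) (snd z) = t"
      by (auto simp: ty0_def split: if_splits)
    moreover have "snd u \<in> V" "snd w \<in> V" "snd z \<in> V" using uwz by (auto simp: V0_def)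
    ultimately show False using tg t(1) unfolding typed_graph_def by blast
  qed
  moreover have "partite T V0 ty0 \<pi>"
    unfolding partite_def
  proof (intro ballI impI)
    fix u w assume uw: "u \<in> V0" "w \<in> V0" "ty0 u w < T"
    then obtain S x y where "u = (S, x)" "w = (S, y)" "ty x y < T"
      by (cases u; cases w) (auto simp: ty0_def split: if_splits)
    then show "\<pi> u \<noteq> \<pi> w" using uw \<pi>_neq adj_neq by (simp add: V0_def)
  qed
  moreover have "finite {(i, j). i < N \<and> j < N \<and> i \<noteq> j}"
    by (rule finite_subset[of _ "{..<N} \<times> {..<N}"]) auto
  ultimately obtain V' :: "nat set" and ty' \<pi>'
    where V': "partite_arrow T r {(i, j). i < N \<and> j < N \<and> i \<noteq> j} V0 ty0 \<pi> V' ty' \<pi>'"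
    using partite_arrow_exists[OF _ _ T r, of V0 ty0 \<pi> "{(i, j). i < N \<and> j < N \<and> i \<noteq> j}"] by blast
  have "\<exists>h \<gamma>. typed_hom T V ty V' ty' h \<and>
      (\<forall>x\<in>V. \<forall>y\<in>V. ty x y < T \<longrightarrow> \<chi> (h x) (h y) = \<gamma> (ty x y))" if \<chi>: "colouring r \<chi>" for \<chi>
  proof -
    obtain h0 \<gamma>0 where h0: "typed_hom T V0 ty0 V' ty' h0"
      and \<gamma>0: "\<And>u w. \<lbrakk>u \<in> V0; w \<in> V0; (\<pi> u, \<pi> w) \<in> {(i, j). i < N \<and> j < N \<and> i \<noteq> j}; ty0 u w < T\<rbrakk> \<Longrightarrow>
        \<chi> (h0 u) (h0 w) = \<gamma>0 (\<pi> u, \<pi> w) (ty0 u w)"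
      by (rule partite_arrow_colouringE[OF V' \<chi>]) blast
    \<comment> \<open>Nothing bounds \<open>\<gamma>0\<close> at types that do not occur;
      \<open>mod r\<close> forces it into range and leaves actual colours unchanged.\<close>
    define f where "f X = (\<lambda>t\<in>{..<T}. \<gamma>0 (Min X, Max X) t mod r)" for X
    have "f \<in> nsets {..<N} 2 \<rightarrow> C" using r by (auto simp: f_def C_def)
    then obtain S c where S: "S \<in> nsets {..<N} p" and c: "\<And>X. X \<in> nsets S 2 \<Longrightarrow> f X = c"
      using N by blast
    have SN: "S \<subseteq> {..<N}" using S by (simp add: nsets_def)
    have V0: "(S, x) \<in> V0" if "x \<in> V" for x using S that by (simp add: V0_def)
    have ty0: "ty0 (S, x) (S, y) = ty x y" for x y by (simp add: ty0_def)
    define h where "h x = h0 (S, x)" for x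
    have "typed_hom T V ty V' ty' h"
      using h0 V0 ty0 unfolding typed_hom_def h_def by (auto simp: Pi_iff)
    moreover have lt: "\<chi> (h x) (h y) = c (ty x y)"
      if "x \<in> V" "y \<in> V" "ty x y < T" "\<pi> (S, x) < \<pi> (S, y)" for x y
    proof -
      have mem: "\<pi> (S, x) \<in> S" "\<pi> (S, y) \<in> S" using \<pi>_in[OF S] that by blast+
      then have "\<chi> (h x) (h y) = \<gamma>0 (\<pi> (S, x), \<pi> (S, y)) (ty x y)"
        unfolding h_def using \<gamma>0[OF V0 V0] that SN ty0 by auto
      moreover have "\<chi> (h x) (h y) < r" using \<chi> by (simp add: colouring_def)
      ultimately have "\<chi> (h x) (h y) = f {\<pi> (S, x), \<pi> (S, y)} (ty x y)"
        using that by (simp add: f_def)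
      moreover have "{\<pi> (S, x), \<pi> (S, y)} \<in> nsets S 2" using mem that(4) by simp
      ultimately show ?thesis using c by simp
    qed
    moreover have "\<chi> (h x) (h y) = c (ty x y)" if "x \<in> V" "y \<in> V" "ty x y < T" for x y
    proof (cases "\<pi> (S, x) < \<pi> (S, y)")
      case True
      then show ?thesis using lt that by blast
    next
      case False
      then have "\<pi> (S, y) < \<pi> (S, x)"
        using \<pi>_neq[OF S] adj_neq that by (metis nat_neq_iff)
      then have "\<chi> (h y) (h x) = c (ty y x)" using lt that ty_sym by metis
      moreover have "\<chi> (h x) (h y) = \<chi> (h y) (h x)" using \<chi> by (simp add: colouring_def)
      ultimately show ?thesis using ty_sym that by simp
    qed
    ultimately show ?thesis by blast
  qed
  then show ?thesis using partite_arrowD(1)[OF V'] by blast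
qed

section \<open>Minimum degree of Ramsey-minimal graphs\<close>

lemma has_copy_K3:
  "has_copy V F K3_V K3_E \<longleftrightarrow> (\<exists>x\<in>V. \<exists>y\<in>V. \<exists>z\<in>V.
     x \<noteq> y \<and> x \<noteq> z \<and> y \<noteq> z \<and> {x, y} \<in> F \<and> {x, z} \<in> F \<and> {y, z} \<in> F)"
proof
  assume "has_copy V F K3_V K3_E"
  then obtain f where f: "inj_on f {0, 1, 2::nat}" "f ` {0, 1, 2} \<subseteq> V"
      "\<forall>e\<in>{{0, 1}, {0, 2}, {1, 2::nat}}. f ` e \<in> F"
    unfolding has_copy_def K3_V_def K3_E_def by blast
  have "f 0 \<noteq> f 1" "f 0 \<noteq> f 2" "f 1 \<noteq> f 2"
    using f(1) by (auto dest: inj_onD)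
  then show "\<exists>x\<in>V. \<exists>y\<in>V. \<exists>z\<in>V.
     x \<noteq> y \<and> x \<noteq> z \<and> y \<noteq> z \<and> {x, y} \<in> F \<and> {x, z} \<in> F \<and> {y, z} \<in> F"
    using f(2,3) by (intro bexI[of _ "f 0"] bexI[of _ "f 1"] bexI[of _ "f 2"]) auto
next
  assume "\<exists>x\<in>V. \<exists>y\<in>V. \<exists>z\<in>V.
     x \<noteq> y \<and> x \<noteq> z \<and> y \<noteq> z \<and> {x, y} \<in> F \<and> {x, z} \<in> F \<and> {y, z} \<in> F"
  then obtain x y z where xyz: "x \<in> V" "y \<in> V" "z \<in> V" "x \<noteq> y" "x \<noteq> z" "y \<noteq> z"
      "{x, y} \<in> F" "{x, z} \<in> F" "{y, z} \<in> F"
    by blast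
  define f where "f i = (if i = 0 then x else if i = 1 then y else z)" for i :: nat
  show "has_copy V F K3_V K3_E"
    unfolding has_copy_def K3_V_def K3_E_def
    using xyz by (intro exI[of _ f]) (auto simp: f_def inj_on_def insert_commute)
qed

lemma ramseyD:
  assumes "ramsey r V E VH EH" "\<And>e. e \<in> E \<Longrightarrow> col e < r"
  shows "\<exists>i<r. has_copy V {e\<in>E. col e = i} VH EH"
proof -
  have "\<forall>e\<in>E. col e < r" using assms(2) by (rule ballI)
  then show ?thesis using assms(1)[unfolded ramsey_def, rule_format, of col] by simp
qed

lemma ramsey_minimal_subgraph:
  assumes "is_graph V E" "ramsey r V E VH EH"
  shows "\<exists>V' E'. V' \<subseteq> V \<and> E' \<subseteq> E \<and> ramsey_minimal r V' E' VH EH"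
  using assms
proof (induction "card V + card E" arbitrary: V E rule: less_induct)
  case less
  show ?case
  proof (cases "ramsey_minimal r V E VH EH")
    case False
    then obtain V' E' where sub: "is_subgraph V' E' V E" "(V', E') \<noteq> (V, E)" "ramsey r V' E' VH EH"
      using less.prems unfolding ramsey_minimal_def by blast
    have fin: "finite V" "finite E"
      using less.prems(1) unfolding is_graph_def by (auto intro: finite_subset[of E "Pow V"])
    have sub': "V' \<subseteq> V" "E' \<subseteq> E" "is_graph V' E'" using sub(1) by (auto simp: is_subgraph_def)
    have "card V' \<le> card V" "card E' \<le> card E" using sub' fin by (auto intro: card_mono)
    moreover have "card V' < card V \<or> card E' < card E"
      using sub(2) sub' fin by (auto intro: psubset_card_mono)
    ultimately have "card V' + card E' < card V + card E" by linarith
    from less.hyps[OF this sub'(3) sub(3)] obtain V'' E''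
      where "V'' \<subseteq> V'" "E'' \<subseteq> E'" "ramsey_minimal r V'' E'' VH EH"
      by (elim exE conjE)
    then show ?thesis using sub'(1,2) by (intro exI[of _ V''] exI[of _ E'']) auto
  next
    case True
    then show ?thesis by (intro exI[of _ V] exI[of _ E]) simp
  qed
qed

lemma min_degree_le:
  assumes "finite V" "v \<in> V"
  shows "min_degree V E \<le> degree E v"
  unfolding min_degree_def
  by (rule Min_le) (use assms in simp_all)

section \<open>The lower bound at a vertex of minimum degree\<close>

lemma ramsey_minimal_min_degree_lower:
  assumes r: "r \<ge> 2" and min: "ramsey_minimal r V E K3_V K3_E"
  shows "real r ^ 2 * ln (real r) / 100000 \<le> real (min_degree V E)"
proof (rule ccontr)
  assume "\<not> ?thesis"
  then have small: "real (min_degree V E) < real r ^ 2 * ln (real r) / 100000" by simp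
  have graph: "is_graph V E" and ram: "ramsey r V E K3_V K3_E"
    and minimal: "\<And>V' E'. \<lbrakk>is_subgraph V' E' V E; (V', E') \<noteq> (V, E)\<rbrakk> \<Longrightarrow> \<not> ramsey r V' E' K3_V K3_E"
    using min by (auto simp: ramsey_minimal_def)
  have finV: "finite V" and E: "\<And>e. e \<in> E \<Longrightarrow> e \<subseteq> V \<and> card e = 2"
    using graph by (auto simp: is_graph_def)
  have finE: "finite E" using finV E by (intro finite_subset[of E "Pow V"]) auto
  \<comment> \<open>Non-emptiness matters because the minimum of an empty set of degrees is
    unspecified.\<close>
  have "V \<noteq> {}"
  proof
    assume "V = {}"
    then have "\<not> has_copy V F K3_V K3_E" for F by (simp add: has_copy_K3)
    then show False using ramseyD[OF ram, of "\<lambda>_. 0"] r by simp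
  qed
  then have "min_degree V E \<in> degree E ` V"
    unfolding min_degree_def using finV by (intro Min_in) auto
  then obtain v where v: "v \<in> V" "degree E v = min_degree V E" by auto
  define N where "N = {x. {v, x} \<in> E}"
  have NV: "N \<subseteq> V - {v}"
    using E by (fastforce simp: N_def)
  have finN: "finite N" using NV finV finite_subset by blast
  have "inj_on (\<lambda>x. {v, x}) N" by (auto simp: inj_on_def doubleton_eq_iff)
  moreover have "(\<lambda>x. {v, x}) ` N \<subseteq> {e\<in>E. v \<in> e}" by (auto simp: N_def)
  ultimately have "card N \<le> degree E v"
    unfolding degree_def using finE by (intro card_inj_on_le[where f="\<lambda>x. {v, x}"]) auto
  then have cardN: "real (card N) < real r ^ 2 * ln (real r) / 100000"
    using small v(2) by simp
  define E' where "E' = {e\<in>E. v \<notin> e}"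
  have "is_subgraph (V - {v}) E' V E"
    using finV E by (auto simp: is_subgraph_def is_graph_def E'_def)
  moreover have "(V - {v}, E') \<noteq> (V, E)" using v(1) by auto
  ultimately have "\<not> ramsey r (V - {v}) E' K3_V K3_E" by (rule minimal)
  then obtain col where col: "\<forall>e\<in>E'. col e < r"
      "\<And>i. i < r \<Longrightarrow> \<not> has_copy (V - {v}) {e\<in>E'. col e = i} K3_V K3_E"
    unfolding ramsey_def by blast
  define adj where "adj i x y \<longleftrightarrow> x \<noteq> y \<and> {x, y} \<in> E' \<and> col {x, y} = i" for i x y
  have "symp (adj i)" for i by (auto simp: symp_def adj_def insert_commute)
  moreover have "triangle_free_on N (adj i)" if "i < r" for i
    using col(2)[OF that] NV unfolding triangle_free_on_def adj_def has_copy_K3 by blast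
  ultimately obtain g where g: "\<And>x. x \<in> N \<Longrightarrow> g x < r"
      "\<And>i. i < r \<Longrightarrow> independent_in (adj i) {x\<in>N. g x = i}"
    using independent_colouring[OF r finN _ _ cardN, of adj] by blast
  define col' where "col' e = (if v \<in> e then g (THE x. e = {v, x}) else col e)" for e
  have col'_v: "col' {v, x} = g x" if "x \<noteq> v" for x
  proof -
    have "(THE y. {v, x} = {v, y}) = x"
      using that by (intro the_equality) (auto simp: doubleton_eq_iff)
    then show ?thesis by (simp add: col'_def)
  qed
  have edge_v: "\<exists>x\<in>N. e = {v, x} \<and> x \<noteq> v" if e: "e \<in> E" "v \<in> e" for e
  proof -
    have "card e = 2" using E[OF e(1)] by simp
    then obtain a b where "e = {a, b}" "a \<noteq> b" by (meson card_2_iff)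
    then show ?thesis using e by (auto simp: N_def insert_commute)
  qed
  have "col' e < r" if e: "e \<in> E" for e
  proof (cases "v \<in> e")
    case True
    then obtain x where "x \<in> N" "e = {v, x}" "x \<noteq> v" using edge_v e by blast
    then show ?thesis using col'_v g(1) by simp
  next
    case False
    then show ?thesis using e col(1) by (simp add: col'_def E'_def)
  qed
  then obtain i where i: "i < r" "has_copy V {e\<in>E. col' e = i} K3_V K3_E"
    using ramseyD[OF ram, of col'] by blast
  then obtain x y z where xyz: "x \<in> V" "y \<in> V" "z \<in> V" "x \<noteq> y" "x \<noteq> z" "y \<noteq> z"
      "{x, y} \<in> E" "{x, z} \<in> E" "{y, z} \<in> E"
      "col' {x, y} = i" "col' {x, z} = i" "col' {y, z} = i"
    unfolding has_copy_K3 by blast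
  \<comment> \<open>Two edges at \<open>v\<close> of colour \<open>i\<close> end in the class of
    \<open>g\<close> for \<open>i\<close>, which spans no edge of colour \<open>i\<close>.\<close>
  have apex: False if "{v, a} \<in> E" "{v, b} \<in> E" "{a, b} \<in> E" "a \<noteq> v" "b \<noteq> v" "a \<noteq> b"
    "col' {v, a} = i" "col' {v, b} = i" "col' {a, b} = i" for a b
  proof -
    have "g a = i" "g b = i" using that col'_v by auto
    moreover have "a \<in> N" "b \<in> N" using that by (auto simp: N_def)
    moreover have "adj i a b" using that by (auto simp: adj_def E'_def col'_def)
    ultimately show False using g(2)[OF i(1)] unfolding independent_in_def by blast
  qed
  show False
  proof (cases "v \<in> {x, y, z}")
    case True
    then consider "v = x" | "v = y" | "v = z" by auto
    then show ?thesis
      by cases (use apex[of y z] apex[of x z] apex[of x y] xyz in \<open>auto simp: insert_commute\<close>)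
  next
    case False
    then have "has_copy (V - {v}) {e\<in>E'. col e = i} K3_V K3_E"
      unfolding has_copy_K3 using xyz
      by (intro bexI[of _ x] bexI[of _ y] bexI[of _ z]) (auto simp: E'_def col'_def)
    then show False using col(2) i(1) by blast
  qed
qed

text \<open>Adding to the pattern, for all types \<open>t \<noteq> s\<close>, a triangle with two edges of type \<open>t\<close> and one
  of type \<open>s\<close> forces distinct types to receive distinct colours.\<close>

lemma typed_graph_add_triangles:
  assumes "typed_graph r {..<n} ty"
  defines "ty' \<equiv> \<lambda>u w :: nat + nat \<times> nat \<times> nat. case (u, w) of
      (Inl x, Inl y) \<Rightarrow> ty x y
    | (Inr (t, s, a), Inr (t', s', b)) \<Rightarrow>
        if t = t' \<and> s = s' \<and> t \<noteq> s \<and> a \<noteq> b then if a + b = 1 then s else t else r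
    | _ \<Rightarrow> r"
  shows "typed_graph r (Inl ` {..<n} \<union> Inr ` ({..<r} \<times> {..<r} \<times> {..<3})) ty'"
  unfolding typed_graph_def
proof (intro conjI ballI allI impI notI)
  let ?V = "Inl ` {..<n} \<union> Inr ` ({..<r} \<times> {..<r} \<times> {..<3}) :: (nat + nat \<times> nat \<times> nat) set"
  show "finite ?V" by simp
  fix u w assume "u \<in> ?V" "w \<in> ?V"
  then show "ty' u w \<le> r" "ty' u w = ty' w u"
    using assms(1) by (auto simp: ty'_def typed_graph_def)
next
  let ?V = "Inl ` {..<n} \<union> Inr ` ({..<r} \<times> {..<r} \<times> {..<3}) :: (nat + nat \<times> nat \<times> nat) set"
  fix u w z :: "nat + nat \<times> nat \<times> nat" and t
  assume mem: "u \<in> ?V" "w \<in> ?V" "z \<in> ?V" and t: "t < r" "ty' u w = t \<and> ty' w z = t \<and> ty' u z = t"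
  show False
  proof (cases u)
    case (Inl x)
    obtain y where "w = Inl y" using t Inl by (cases w) (auto simp: ty'_def)
    moreover obtain z' where "z = Inl z'" using t Inl by (cases z) (auto simp: ty'_def)
    ultimately have "x < n" "y < n" "z' < n" "ty x y = t" "ty y z' = t" "ty x z' = t"
      using mem t Inl by (auto simp: ty'_def)
    then show False using assms(1) t(1) unfolding typed_graph_def by blast
  next
    case (Inr q)
    obtain t1 s1 a where u: "u = Inr (t1, s1, a)" using Inr by (cases q) auto
    obtain b where w: "w = Inr (t1, s1, b)" "a \<noteq> b" "t1 \<noteq> s1"
      using t u by (cases w) (auto simp: ty'_def split: if_splits prod.splits)
    obtain c where z: "z = Inr (t1, s1, c)" "a \<noteq> c"
      using t u by (cases z) (auto simp: ty'_def split: if_splits prod.splits)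
    have "b \<noteq> c" using t w z by (auto simp: ty'_def)
    moreover have "a < 3" "b < 3" "c < 3" using mem u w z by auto
    \<comment> \<open>\<open>a\<close>, \<open>b\<close>, \<open>c\<close> are \<open>0\<close>,
      \<open>1\<close>, \<open>2\<close> in some order and only \<open>0 + 1\<close> equals
      \<open>1\<close>, so exactly one of the three edges has type \<open>s1\<close> and the other
      two have type \<open>t1\<close>.\<close>
    ultimately have "a + b = 1 \<or> b + c = 1 \<or> a + c = 1" "\<not> (a + b = 1 \<and> b + c = 1)"
        "\<not> (a + b = 1 \<and> a + c = 1)" "\<not> (b + c = 1 \<and> a + c = 1)"
      using w z by linarith+
    then show False
      using t(2) u w z \<open>b \<noteq> c\<close> by (auto simp: ty'_def split: if_splits)
  qed
qed


section \<open>From an unavoidable pattern to a Ramsey-minimal graph\<close>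

text \<open>Without a monochromatic triangle, \<open>\<gamma>\<close> permutes the colours.
  Translating the colours of the edges at \<open>apex S\<close> by its inverse gives
  \<open>g\<close>, and the edge supplied by \<open>unavoidable\<close> then closes a monochromatic
  triangle with \<open>apex S\<close>. On the other hand the types themselves colour
  \<open>F\<close> well, so a minimal subgraph keeps some apex, and its degree is at most
  \<open>n\<close>.\<close>

lemma ramsey_minimal_from_pattern:
  assumes r: "r \<ge> 2" and tg: "typed_graph r {..<n} ty"
    and unavoidable: "\<And>g. \<forall>x<n. g x < r \<Longrightarrow> \<exists>x<n. \<exists>y<n. g x = g y \<and> ty x y = g x"
  shows "\<exists>(V :: nat set) E. ramsey_minimal r V E K3_V K3_E \<and> min_degree V E \<le> n"
proof -
  define P :: "(nat + nat \<times> nat \<times> nat) set"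
    where "P = Inl ` {..<n} \<union> Inr ` ({..<r} \<times> {..<r} \<times> {..<3})"
  define tyP where "tyP = (\<lambda>u w :: nat + nat \<times> nat \<times> nat. case (u, w) of
      (Inl x, Inl y) \<Rightarrow> ty x y
    | (Inr (t, s, a), Inr (t', s', b)) \<Rightarrow>
        if t = t' \<and> s = s' \<and> t \<noteq> s \<and> a \<noteq> b then if a + b = 1 then s else t else r
    | _ \<Rightarrow> r)"
  have "typed_graph r P tyP"
    unfolding P_def tyP_def by (rule typed_graph_add_triangles[OF tg])
  then obtain F :: "nat set" and tyF where tgF: "typed_graph r F tyF"
    and arrow: "\<And>\<chi>. colouring r \<chi> \<Longrightarrow> \<exists>h \<gamma>. typed_hom r P tyP F tyF h \<and>
      (\<forall>x\<in>P. \<forall>y\<in>P. tyP x y < r \<longrightarrow> \<chi> (h x) (h y) = \<gamma> (tyP x y))"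
    using typed_ramsey[of r P tyP r] r by auto
  have finF: "finite F" and symF: "\<And>x y. x \<in> F \<Longrightarrow> y \<in> F \<Longrightarrow> tyF x y = tyF y x"
    using tgF by (auto simp: typed_graph_def)
  have looplessF: "x \<noteq> y" if "x \<in> F" "tyF x y < r" for x y
    using typed_graph_loopless[OF tgF that(1)] that by auto
  obtain B where B: "F \<subseteq> {..<B}" using finF finite_nat_iff_bounded by blast
  define EF where "EF = {{x, y} | x y. x \<in> F \<and> y \<in> F \<and> tyF x y < r}"
  \<comment> \<open>Smaller sets are included since a homomorphism may identify pattern
    vertices.\<close>
  define \<W> where "\<W> = {S. S \<subseteq> F \<and> card S \<le> n}"
  \<comment> \<open>The shift by \<open>B\<close> puts the new vertices outside \<open>F\<close>;
    \<open>set_encode\<close> keeps them distinct.\<close>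
  define apex where "apex S = B + set_encode S" for S
  have finW: "finite \<W>" using finF by (simp add: \<W>_def)
  have apex_F: "apex S \<notin> F" for S using B by (auto simp: apex_def)
  have apex_inj: "S = S'" if "S \<in> \<W>" "S' \<in> \<W>" "apex S = apex S'" for S S'
  proof -
    have "finite S" "finite S'" using that finF by (auto simp: \<W>_def intro: finite_subset)
    then show ?thesis using that(3) set_encode_eq by (simp add: apex_def)
  qed
  define V where "V = F \<union> apex ` \<W>"
  define E where "E = EF \<union> {{apex S, x} | S x. S \<in> \<W> \<and> x \<in> S}"
  have graph: "is_graph V E"
    unfolding is_graph_def
  proof (intro conjI ballI)
    show "finite V" using finF finW by (simp add: V_def)
    fix e assume "e \<in> E"
    then have "(\<exists>x y. e = {x, y} \<and> x \<in> F \<and> y \<in> F \<and> tyF x y < r) \<or> (\<exists>S x. e = {apex S, x} \<and> S \<in> \<W> \<and> x \<in> S)"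
      by (simp add: E_def EF_def)
    then have "e \<subseteq> V \<and> card e = 2"
    proof (elim disjE exE conjE)
      fix x y assume "e = {x, y}" "x \<in> F" "y \<in> F" "tyF x y < r"
      then show ?thesis using looplessF[of x y] by (simp add: V_def)
    next
      fix S x assume S: "e = {apex S, x}" "S \<in> \<W>" "x \<in> S"
      then have "x \<in> F" by (auto simp: \<W>_def)
      moreover from this have "x \<noteq> apex S" using apex_F by metis
      ultimately show ?thesis using S by (simp add: V_def)
    qed
    then show "e \<subseteq> V" "card e = 2" by simp_all
  qed
  have ram: "ramsey r V E K3_V K3_E"
    unfolding ramsey_def
  proof (intro allI impI)
    fix col :: "nat set \<Rightarrow> nat" assume col: "\<forall>e\<in>E. col e < r"
    define \<chi> where "\<chi> x y = (if {x, y} \<in> E then col {x, y} else 0)" for x y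
    have "colouring r \<chi>"
      using col r by (auto simp: colouring_def \<chi>_def insert_commute)
    then obtain h \<gamma> where h: "typed_hom r P tyP F tyF h"
      and \<gamma>: "\<forall>x\<in>P. \<forall>y\<in>P. tyP x y < r \<longrightarrow> \<chi> (h x) (h y) = \<gamma> (tyP x y)"
      using arrow by blast
    have hF: "h x \<in> F" if "x \<in> P" for x using h that by (auto simp: typed_hom_def)
    have edge: "{h x, h y} \<in> E \<and> h x \<noteq> h y \<and> col {h x, h y} = \<gamma> (tyP x y) \<and> \<gamma> (tyP x y) < r"
      if "x \<in> P" "y \<in> P" "tyP x y < r" for x y
    proof -
      have "tyF (h x) (h y) < r" using h that by (simp add: typed_hom_def)
      then have e: "{h x, h y} \<in> E" "h x \<noteq> h y"
        using hF looplessF that unfolding E_def EF_def by blast+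
      have "\<chi> (h x) (h y) = \<gamma> (tyP x y)" using \<gamma> that by blast
      then have "col {h x, h y} = \<gamma> (tyP x y)" using e(1) by (simp add: \<chi>_def)
      then show ?thesis using e col by auto
    qed
    show "\<exists>i<r. has_copy V {e\<in>E. col e = i} K3_V K3_E"
    proof (rule ccontr)
      assume none: "\<not> ?thesis"
      have mono: False if "{x, y} \<in> E" "{x, z} \<in> E" "{y, z} \<in> E" "x \<noteq> y" "x \<noteq> z" "y \<noteq> z"
        "x \<in> V" "y \<in> V" "z \<in> V" "col {x, y} = i" "col {x, z} = i" "col {y, z} = i" "i < r" for x y z i
      proof -
        have "has_copy V {e\<in>E. col e = i} K3_V K3_E"
          unfolding has_copy_K3 using that
          by (intro bexI[of _ x] bexI[of _ y] bexI[of _ z]) auto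
        then show False using none that by blast
      qed
      have FV: "x \<in> V" if "x \<in> F" for x using that by (simp add: V_def)
      have \<gamma>_inj: "inj_on \<gamma> {..<r}"
      proof (rule inj_onI, rule ccontr)
        fix t s assume ts: "t \<in> {..<r}" "s \<in> {..<r}" "\<gamma> t = \<gamma> s" "t \<noteq> s"
        define q where "q a = (Inr (t, s, a) :: nat + nat \<times> nat \<times> nat)" for a
        have q: "q 0 \<in> P" "q 1 \<in> P" "q 2 \<in> P" using ts by (auto simp: q_def P_def)
        have ty: "tyP (q 0) (q 1) = s" "tyP (q 0) (q 2) = t" "tyP (q 1) (q 2) = t"
          using ts(4) by (simp_all add: q_def tyP_def)
        show False
          using mono[of "h (q 0)" "h (q 1)" "h (q 2)" "\<gamma> t"] edge[OF q(1,2)] edge[OF q(1,3)] edge[OF q(2,3)]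
            ty ts hF q FV by auto
      qed
      have \<gamma>_less: "\<gamma> t < r" if t: "t < r" for t
      proof -
        \<comment> \<open>Any second type, available as \<open>r \<ge> 2\<close>: the added triangle
          for \<open>(t, s)\<close> makes type \<open>t\<close> occur in the pattern, so
          \<open>\<gamma> t\<close> is the colour of some edge.\<close>
        define s :: nat where "s = (if t = 0 then 1 else 0)"
        have s: "s < r" "s \<noteq> t" using r by (auto simp: s_def)
        define q where "q a = (Inr (t, s, a) :: nat + nat \<times> nat \<times> nat)" for a
        have q: "q 0 \<in> P" "q 2 \<in> P" using t s by (auto simp: q_def P_def)
        have "tyP (q 0) (q 2) = t" using s(2) by (simp add: q_def tyP_def)
        then show ?thesis using edge[OF q] t by simp
      qed
      have \<gamma>_bij: "\<gamma> ` {..<r} = {..<r}"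
        using \<gamma>_inj \<gamma>_less by (intro endo_inj_surj) auto
      define S where "S = (\<lambda>x. h (Inl x)) ` {..<n}"
      have Inl_P: "Inl x \<in> P" if "x < n" for x using that by (simp add: P_def)
      have "card S \<le> n" unfolding S_def using card_image_le[of "{..<n}"] by fastforce
      then have SW: "S \<in> \<W>" using hF Inl_P by (auto simp: \<W>_def S_def)
      define g where "g x = inv_into {..<r} \<gamma> (col {apex S, h (Inl x)})" for x
      have apex_edge: "{apex S, h (Inl x)} \<in> E" if "x < n" for x
        using that SW unfolding E_def S_def by blast
      have g: "g x < r" "\<gamma> (g x) = col {apex S, h (Inl x)}" if "x < n" for x
      proof -
        have "col {apex S, h (Inl x)} \<in> \<gamma> ` {..<r}"
          using apex_edge[OF that] col \<gamma>_bij by auto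
        then show "g x < r" "\<gamma> (g x) = col {apex S, h (Inl x)}"
          unfolding g_def using inv_into_into[of _ \<gamma> "{..<r}"] by (auto simp: f_inv_into_f)
      qed
      then obtain x y where xy: "x < n" "y < n" "g x = g y" "ty x y = g x"
        using unavoidable[of g] by blast
      have "tyP (Inl x) (Inl y) = g x" using xy(4) by (simp add: tyP_def)
      then have "{h (Inl x), h (Inl y)} \<in> E" "h (Inl x) \<noteq> h (Inl y)"
          "col {h (Inl x), h (Inl y)} = \<gamma> (g x)"
        using edge[OF Inl_P Inl_P, of x y] xy g(1) by simp_all
      moreover have "col {apex S, h (Inl x)} = \<gamma> (g x)" "col {apex S, h (Inl y)} = \<gamma> (g x)"
        using g(2)[OF xy(1)] g(2)[OF xy(2)] xy(3) by simp_all
      moreover have "apex S \<in> V" using SW by (simp add: V_def)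
      moreover have "apex S \<noteq> h (Inl x)" "apex S \<noteq> h (Inl y)"
        using apex_F hF Inl_P xy by metis+
      ultimately show False
        using mono[of "apex S" "h (Inl x)" "h (Inl y)" "\<gamma> (g x)"] apex_edge xy FV hF Inl_P g(1) \<gamma>_less
        by auto
    qed
  qed
  obtain V' E' where min: "V' \<subseteq> V" "E' \<subseteq> E" "ramsey_minimal r V' E' K3_V K3_E"
    using ramsey_minimal_subgraph[OF graph ram] by (elim exE conjE)
  have graph': "is_graph V' E'" and ram': "ramsey r V' E' K3_V K3_E"
    using min(3) by (simp_all add: ramsey_minimal_def)
  have "\<exists>S\<in>\<W>. apex S \<in> V'"
  proof (rule ccontr)
    assume no_apex: "\<not> ?thesis"
    have E'_EF: "E' \<subseteq> EF"
    proof
      fix e assume e: "e \<in> E'"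
      then have "e \<subseteq> V'" using graph' by (simp add: is_graph_def)
      then show "e \<in> EF" using e min(2) no_apex unfolding E_def by blast
    qed
    \<comment> \<open>Types serve as colours; \<open>Min\<close> and \<open>Max\<close> recover the
      ends of an edge, in an order that symmetry makes irrelevant.\<close>
    define col where "col e = tyF (Min e) (Max e)" for e
    have col: "col {x, y} = tyF x y" if "x \<in> F" "y \<in> F" for x y
      using symF that by (cases "x \<le> y") (auto simp: col_def min_def max_def)
    have "col e < r" if "e \<in> E'" for e
      using that E'_EF col unfolding EF_def by auto
    then obtain i where i: "i < r" "has_copy V' {e\<in>E'. col e = i} K3_V K3_E"
      using ramseyD[OF ram', of col] by blast
    then obtain x y z where xyz: "{x, y} \<in> E'" "{x, z} \<in> E'" "{y, z} \<in> E'"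
      "col {x, y} = i" "col {x, z} = i" "col {y, z} = i"
      unfolding has_copy_K3 by blast
    have "x \<in> F" "y \<in> F" "z \<in> F"
      using xyz(1,2) E'_EF unfolding EF_def by (auto simp: doubleton_eq_iff)
    moreover from this have "tyF x y = i" "tyF x z = i" "tyF y z = i" using xyz col by auto
    ultimately show False using tgF i(1) unfolding typed_graph_def by blast
  qed
  then obtain S where S: "S \<in> \<W>" "apex S \<in> V'" by blast
  have finS: "finite S" using S(1) finF by (auto simp: \<W>_def intro: finite_subset)
  have "{e\<in>E'. apex S \<in> e} \<subseteq> (\<lambda>x. {apex S, x}) ` S"
  proof
    fix e assume "e \<in> {e\<in>E'. apex S \<in> e}"
    then have e: "e \<in> E" "apex S \<in> e" using min(2) by auto
    have "e \<notin> EF" using e(2) apex_F unfolding EF_def by blast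
    then obtain S' x where e': "e = {apex S', x}" "S' \<in> \<W>" "x \<in> S'" using e(1) unfolding E_def by blast
    have "x \<in> F" using e' by (auto simp: \<W>_def)
    then have "apex S = apex S'" using e(2) e'(1) apex_F by auto
    then have "S' = S" using apex_inj S(1) e'(2) by blast
    then show "e \<in> (\<lambda>x. {apex S, x}) ` S" using e' by blast
  qed
  then have "degree E' (apex S) \<le> card S"
    unfolding degree_def using finS by (meson card_image_le card_mono finite_imageI order.trans)
  also have "\<dots> \<le> n" using S(1) by (simp add: \<W>_def)
  finally have "min_degree V' E' \<le> n"
    using min_degree_le[of V' "apex S" E'] S(2) graph' by (simp add: is_graph_def)
  then show ?thesis using min(3) by blast
qed

section \<open>Packing triangle-free graphs with small independence number\<close>

text \<open>Keep only the term of index \<open>y\<close> in the expansion of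
  \<open>(x + 1) ^ m\<close> with \<open>x = y / m\<close>, and use
  \<open>x + 1 \<le> exp x\<close>.\<close>

lemma binomial_le_exp_power:
  assumes "m > 0" "y > 0"
  shows "real (m choose y) \<le> (exp 1 * real m / real y) ^ y"
proof (cases "y \<le> m")
  case True
  define x where "x = real y / real m"
  have x: "x > 0" using assms by (simp add: x_def)
  have "real (m choose y) * x ^ y \<le> (\<Sum>j\<le>m. real (m choose j) * x ^ j * 1 ^ (m - j))"
    using True x by (subst sum.remove[of _ y]) (auto intro!: sum_nonneg)
  also have "\<dots> = (x + 1) ^ m" by (rule binomial_ring[symmetric])
  also have "\<dots> \<le> exp x ^ m" using x by (intro power_mono) (auto simp: add.commute)
  also have "\<dots> = exp 1 ^ y"
    using assms by (simp add: x_def flip: exp_of_nat_mult)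
  finally have "real (m choose y) \<le> exp 1 ^ y / x ^ y" using x by (simp add: field_simps)
  then show ?thesis using assms by (simp add: x_def power_divide power_mult_distrib)
qed (simp add: binomial_eq_0)

section \<open>Counting edge colourings of a complete graph\<close>

text \<open>Independence of the edges turns the sum into a product. The weights \<open>1, 0\<close>
  count colourings with prescribed colours exactly; the weights \<open>1/2, 1\<close> give an
  exponential moment for the lower tail.\<close>

lemma sum_uniform_colourings:
  fixes a b :: real
  assumes fin: "finite E" and A: "A \<subseteq> E" and i: "i < R"
  shows "(\<Sum>f\<in>E \<rightarrow>\<^sub>E {..<R}. \<Prod>e\<in>A. if f e = i then a else b)
    = real R ^ card E * ((a + (real R - 1) * b) / real R) ^ card A"
proof -
  define q where "q = (a + (real R - 1) * b) / real R"
  define w where "w e c = (if e \<in> A then if c = i then a else b else 1)" for e c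
  have col: "(\<Sum>c<R. w e c) = real R * (if e \<in> A then q else 1)" for e
  proof (cases "e \<in> A")
    case True
    have "(\<Sum>c<R. if c = i then a else b) = (\<Sum>c\<in>{..<R} - {i}. b) + a"
      using i by (subst sum.remove[of _ i]) auto
    also have "\<dots> = (real R - 1) * b + a" using i by (simp add: of_nat_diff)
    finally show ?thesis using True i by (simp add: w_def q_def)
  qed (simp add: w_def)
  have prod: "(\<Prod>e\<in>A. u e) = (\<Prod>e\<in>E. if e \<in> A then u e else 1)" for u :: "'a \<Rightarrow> real"
    using prod.inter_restrict[OF fin, of u A] A by (simp add: Int_absorb1)
  have "(\<Sum>f\<in>E \<rightarrow>\<^sub>E {..<R}. \<Prod>e\<in>A. if f e = i then a else b)
      = (\<Sum>f\<in>E \<rightarrow>\<^sub>E {..<R}. \<Prod>e\<in>E. w e (f e))"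
    unfolding prod w_def ..
  also have "\<dots> = (\<Prod>e\<in>E. \<Sum>c<R. w e c)"
    using fin by (intro prod_sum_PiE[symmetric]) auto
  also have "\<dots> = real R ^ card E * (\<Prod>e\<in>A. q)"
    unfolding col prod.distrib prod by simp
  finally show ?thesis by (simp add: q_def)
qed

lemma card_colourings_fixed:
  assumes "finite E" "A \<subseteq> E" "i < R"
  shows "real (card {f \<in> E \<rightarrow>\<^sub>E {..<R}. \<forall>e\<in>A. f e = i}) = real R ^ card E / real R ^ card A"
proof -
  have finA: "finite A" using assms finite_subset by blast
  have fin\<Omega>: "finite (E \<rightarrow>\<^sub>E {..<R})" using assms(1) by (simp add: finite_PiE)
  have ind: "(\<Prod>e\<in>A. if f e = i then 1 else 0 :: real) = (if \<forall>e\<in>A. f e = i then 1 else 0)" for f :: "'a \<Rightarrow> nat"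
    using finA by (induction A rule: finite_induct) auto
  have "real (card {f \<in> E \<rightarrow>\<^sub>E {..<R}. \<forall>e\<in>A. f e = i})
      = (\<Sum>f\<in>E \<rightarrow>\<^sub>E {..<R}. if \<forall>e\<in>A. f e = i then 1 else 0)"
    using fin\<Omega> by (simp add: sum.If_cases Int_def)
  also have "\<dots> = real R ^ card E * ((1 + (real R - 1) * 0) / real R) ^ card A"
    unfolding ind[symmetric] by (rule sum_uniform_colourings[OF assms])
  finally show ?thesis by (simp add: power_divide)
qed

text \<open>Markov's inequality for \<open>(1/2) ^ X\<close>, where \<open>X\<close> is the number
  of elements of \<open>A\<close> of colour \<open>i\<close>.\<close>

lemma card_colourings_rare:
  assumes "finite E" "A \<subseteq> E" "i < R"
  shows "real (card {f \<in> E \<rightarrow>\<^sub>E {..<R}. card {e\<in>A. f e = i} \<le> j})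
    \<le> real R ^ card E * (2 ^ j * (1 - 1 / (2 * real R)) ^ card A)"
proof -
  have finA: "finite A" using assms finite_subset by blast
  have fin\<Omega>: "finite (E \<rightarrow>\<^sub>E {..<R})" using assms(1) by (simp add: finite_PiE)
  have half: "(\<Prod>e\<in>A. if f e = i then 1/2 else 1 :: real) = (1/2) ^ card {e\<in>A. f e = i}" for f :: "'a \<Rightarrow> nat"
    using finA by (simp add: prod.If_cases Int_def)
  have "real (card {f \<in> E \<rightarrow>\<^sub>E {..<R}. card {e\<in>A. f e = i} \<le> j})
      = (\<Sum>f\<in>{f \<in> E \<rightarrow>\<^sub>E {..<R}. card {e\<in>A. f e = i} \<le> j}. 1)" by simp
  also have "\<dots> \<le> (\<Sum>f\<in>{f \<in> E \<rightarrow>\<^sub>E {..<R}. card {e\<in>A. f e = i} \<le> j}. 2 ^ j * (1/2) ^ card {e\<in>A. f e = i})"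
  proof (rule sum_mono)
    fix f assume "f \<in> {f \<in> E \<rightarrow>\<^sub>E {..<R}. card {e\<in>A. f e = i} \<le> j}"
    then have "(2::real) ^ card {e\<in>A. f e = i} \<le> 2 ^ j" by (intro power_increasing) auto
    then show "(1::real) \<le> 2 ^ j * (1/2) ^ card {e\<in>A. f e = i}" by (simp add: power_divide)
  qed
  also have "\<dots> \<le> (\<Sum>f\<in>E \<rightarrow>\<^sub>E {..<R}. 2 ^ j * (1/2) ^ card {e\<in>A. f e = i})"
    using fin\<Omega> by (intro sum_mono2) auto
  also have "\<dots> = 2 ^ j * (\<Sum>f\<in>E \<rightarrow>\<^sub>E {..<R}. \<Prod>e\<in>A. if f e = i then 1/2 else 1)"
    unfolding half by (rule sum_distrib_left[symmetric])
  also have "\<dots> = 2 ^ j * (real R ^ card E * ((1/2 + (real R - 1) * 1) / real R) ^ card A)"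
    by (subst sum_uniform_colourings[OF assms]) simp
  also have "(1/2 + (real R - 1) * 1) / real R = 1 - 1 / (2 * real R)"
    using assms(3) by (simp add: field_simps)
  finally show ?thesis by (simp add: mult_ac)
qed

definition triangles_meeting :: "nat \<Rightarrow> nat set \<Rightarrow> nat set set" where
  "triangles_meeting n S = {\<tau>\<in>nsets {..<n} 3. nsets \<tau> 2 \<inter> nsets S 2 \<noteq> {}}"

definition edge_disjoint :: "nat set set \<Rightarrow> bool" where
  "edge_disjoint \<T> \<longleftrightarrow> (\<forall>\<tau>\<in>\<T>. \<forall>\<tau>'\<in>\<T>. \<tau> \<noteq> \<tau>' \<longrightarrow> nsets \<tau> 2 \<inter> nsets \<tau>' 2 = {})"

lemma finite_triangles_meeting: "finite (triangles_meeting n S)"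
  by (simp add: triangles_meeting_def finite_imp_finite_nsets)

lemma card_triangles_meeting:
  assumes "finite S" "card S = k"
  shows "card (triangles_meeting n S) \<le> (k choose 2) * n"
proof -
  have "triangles_meeting n S \<subseteq> (\<lambda>(e, v). insert v e) ` (nsets S 2 \<times> {..<n})"
  proof
    fix \<tau> assume \<tau>: "\<tau> \<in> triangles_meeting n S"
    then obtain e where e: "e \<in> nsets \<tau> 2" "e \<in> nsets S 2" by (auto simp: triangles_meeting_def)
    have t: "\<tau> \<subseteq> {..<n}" "finite \<tau>" "card \<tau> = 3" using \<tau> by (auto simp: triangles_meeting_def nsets_def)
    have e': "e \<subseteq> \<tau>" "card e = 2" "finite e" using e(1) by (auto simp: nsets_def)
    then have "card (\<tau> - e) = 1" using t by (simp add: card_Diff_subset)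
    then obtain v where "\<tau> - e = {v}" by (meson card_1_singletonE)
    then have "\<tau> = insert v e" "v < n" using e' t by auto
    then show "\<tau> \<in> (\<lambda>(e, v). insert v e) ` (nsets S 2 \<times> {..<n})" using e(2) by force
  qed
  then have "card (triangles_meeting n S) \<le> card ((\<lambda>(e, v). insert v e) ` (nsets S 2 \<times> {..<n}))"
    using assms by (intro card_mono) (auto simp: finite_imp_finite_nsets)
  also have "\<dots> \<le> card (nsets S 2 \<times> {..<n})"
    using assms by (intro card_image_le) (auto simp: finite_imp_finite_nsets)
  finally show ?thesis using assms by (simp add: card_cartesian_product)
qed

lemma card_Union_edges:
  assumes "edge_disjoint \<T>" "finite \<T>" "\<T> \<subseteq> nsets {..<n} 3"
  shows "card (\<Union>\<tau>\<in>\<T>. nsets \<tau> 2) = 3 * card \<T>"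
proof -
  have "card (nsets \<tau> 2) = 3" "finite (nsets \<tau> 2)" if "\<tau> \<in> \<T>" for \<tau>
  proof -
    have "finite \<tau>" "card \<tau> = 3" using assms(3) that by (auto simp: nsets_def)
    then show "card (nsets \<tau> 2) = 3" "finite (nsets \<tau> 2)"
      by (simp_all add: finite_imp_finite_nsets numeral_eq_Suc)
  qed
  then show ?thesis
    using assms(1,2) by (subst card_UN_disjoint) (auto simp: edge_disjoint_def)
qed

text \<open>Edge-disjointness avoids upper-tail estimates for dependent triangles: a family of
  \<open>y\<close> such triangles has exactly \<open>3 * y\<close> edges, so it is entirely of
  colour \<open>i\<close> with probability \<open>1 / R ^ (3 * y)\<close>, and a union bound over
  the families suffices.\<close>

lemma card_colourings_many_triangles:
  assumes S: "S \<in> nsets {..<n} k" and i: "i < R"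
  defines "E \<equiv> nsets {..<n} 2"
  shows "real (card {f \<in> E \<rightarrow>\<^sub>E {..<R}. \<exists>\<T>\<subseteq>triangles_meeting n S. card \<T> = y \<and> edge_disjoint \<T> \<and>
      (\<forall>\<tau>\<in>\<T>. \<forall>e\<in>nsets \<tau> 2. f e = i)})
    \<le> real R ^ card E * (real (((k choose 2) * n) choose y) / real R ^ (3 * y))"
proof -
  define M where "M = triangles_meeting n S"
  define F where "F = {\<T>. \<T> \<subseteq> M \<and> card \<T> = y \<and> edge_disjoint \<T>}"
  define A where "A \<T> = {f \<in> E \<rightarrow>\<^sub>E {..<R}. \<forall>e\<in>(\<Union>\<tau>\<in>\<T>. nsets \<tau> 2). f e = i}" for \<T>
  have finE: "finite E" by (simp add: E_def finite_imp_finite_nsets)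
  have finM: "finite M" unfolding M_def by (rule finite_triangles_meeting)
  have M3: "M \<subseteq> nsets {..<n} 3" by (auto simp: M_def triangles_meeting_def)
  have finF: "finite F" unfolding F_def using finM by simp
  have "card F \<le> card (nsets M y)"
    unfolding F_def using finM by (intro card_mono) (auto simp: nsets_def finite_subset finite_imp_finite_nsets[unfolded nsets_def])
  also have "\<dots> \<le> ((k choose 2) * n) choose y"
    using card_triangles_meeting[of S k n] S unfolding M_def card_nsets
    by (intro binomial_right_mono) (auto simp: nsets_def)
  finally have cardF: "card F \<le> ((k choose 2) * n) choose y" .
  have "{f \<in> E \<rightarrow>\<^sub>E {..<R}. \<exists>\<T>\<subseteq>triangles_meeting n S. card \<T> = y \<and> edge_disjoint \<T> \<and>
      (\<forall>\<tau>\<in>\<T>. \<forall>e\<in>nsets \<tau> 2. f e = i)} = (\<Union>\<T>\<in>F. A \<T>)"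
    unfolding F_def A_def M_def by auto
  moreover have "real (card (\<Union>\<T>\<in>F. A \<T>)) \<le> (\<Sum>\<T>\<in>F. real (card (A \<T>)))"
    using card_UN_le[OF finF, of A] by (simp flip: of_nat_sum)
  moreover have "real (card (A \<T>)) = real R ^ card E / real R ^ (3 * y)" if "\<T> \<in> F" for \<T>
  proof -
    have \<T>: "\<T> \<subseteq> M" "card \<T> = y" "edge_disjoint \<T>" using that by (auto simp: F_def)
    have "nsets \<tau> 2 \<subseteq> E" if "\<tau> \<in> \<T>" for \<tau>
      unfolding E_def using that \<T>(1) M3 by (intro nsets_mono) (auto simp: nsets_def)
    then have "(\<Union>\<tau>\<in>\<T>. nsets \<tau> 2) \<subseteq> E" by blast
    then have "real (card (A \<T>)) = real R ^ card E / real R ^ card (\<Union>\<tau>\<in>\<T>. nsets \<tau> 2)"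
      unfolding A_def by (rule card_colourings_fixed[OF finE _ i])
    also have "card (\<Union>\<tau>\<in>\<T>. nsets \<tau> 2) = 3 * y"
      using card_Union_edges[OF \<T>(3) finite_subset[OF \<T>(1) finM] order.trans[OF \<T>(1) M3]] \<T>(2)
      by simp
    finally show ?thesis .
  qed
  ultimately have "real (card {f \<in> E \<rightarrow>\<^sub>E {..<R}. \<exists>\<T>\<subseteq>triangles_meeting n S. card \<T> = y \<and> edge_disjoint \<T> \<and>
      (\<forall>\<tau>\<in>\<T>. \<forall>e\<in>nsets \<tau> 2. f e = i)}) \<le> real (card F) * (real R ^ card E / real R ^ (3 * y))"
    by simp
  also have "\<dots> \<le> real (((k choose 2) * n) choose y) * (real R ^ card E / real R ^ (3 * y))"
    using cardF by (intro mult_right_mono) auto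
  finally show ?thesis by (simp add: mult_ac)
qed

lemma good_colouring_exists:
  assumes r: "r \<le> R"
    and bound: "real r * real (n choose k) * (2 ^ (3 * y) * (1 - 1 / (2 * real R)) ^ (k choose 2)
      + real (((k choose 2) * n) choose y) / real R ^ (3 * y)) < 1"
    and R: "R > 0"
  obtains f where "\<And>i S. i < r \<Longrightarrow> S \<in> nsets {..<n} k \<Longrightarrow> 3 * y < card {e\<in>nsets S 2. f e = (i::nat)}"
    "\<And>i S \<T>. i < r \<Longrightarrow> S \<in> nsets {..<n} k \<Longrightarrow> \<T> \<subseteq> triangles_meeting n S \<Longrightarrow> card \<T> = y \<Longrightarrow>
      edge_disjoint \<T> \<Longrightarrow> \<exists>\<tau>\<in>\<T>. \<exists>e\<in>nsets \<tau> 2. f e \<noteq> i"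
proof -
  define E :: "nat set set" where "E = nsets {..<n} 2"
  define \<Omega> where "\<Omega> = E \<rightarrow>\<^sub>E {..<R}"
  define X1 where "X1 p = {f \<in> \<Omega>. card {e\<in>nsets (snd p) 2. f e = fst p} \<le> 3 * y}" for p :: "nat \<times> nat set"
  define X2 where "X2 p = {f \<in> \<Omega>. \<exists>\<T>\<subseteq>triangles_meeting n (snd p). card \<T> = y \<and> edge_disjoint \<T> \<and>
      (\<forall>\<tau>\<in>\<T>. \<forall>e\<in>nsets \<tau> 2. f e = fst p)}" for p :: "nat \<times> nat set"
  define I where "I = {..<r} \<times> nsets {..<n} k"
  have finE: "finite E" by (simp add: E_def finite_imp_finite_nsets)
  have fin\<Omega>: "finite \<Omega>" unfolding \<Omega>_def using finE by (simp add: finite_PiE)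
  have finI: "finite I" by (simp add: I_def finite_imp_finite_nsets)
  have card\<Omega>: "real (card \<Omega>) = real R ^ card E" unfolding \<Omega>_def using finE by (simp add: card_PiE)
  define \<beta> where "\<beta> = 2 ^ (3 * y) * (1 - 1 / (2 * real R)) ^ (k choose 2)
      + real (((k choose 2) * n) choose y) / real R ^ (3 * y)"
  have each: "real (card (X1 p \<union> X2 p)) \<le> real R ^ card E * \<beta>" if "p \<in> I" for p
  proof -
    obtain i S where p: "p = (i, S)" by (cases p)
    have iS: "i < R" "S \<in> nsets {..<n} k" using that r p by (auto simp: I_def)
    have "nsets S 2 \<subseteq> E" unfolding E_def using iS(2) by (intro nsets_mono) (simp add: nsets_def)
    moreover have "card (nsets S 2) = k choose 2"
      using iS(2) unfolding card_nsets by (simp add: nsets_def)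
    ultimately have "real (card (X1 p)) \<le> real R ^ card E * (2 ^ (3 * y) * (1 - 1 / (2 * real R)) ^ (k choose 2))"
      unfolding X1_def \<Omega>_def p fst_conv snd_conv using card_colourings_rare[OF finE _ iS(1), of "nsets S 2" "3 * y"]
      by simp
    moreover have "real (card (X2 p)) \<le> real R ^ card E * (real (((k choose 2) * n) choose y) / real R ^ (3 * y))"
      unfolding X2_def \<Omega>_def p fst_conv snd_conv E_def by (rule card_colourings_many_triangles[OF iS(2,1)])
    moreover have "real (card (X1 p \<union> X2 p)) \<le> real (card (X1 p)) + real (card (X2 p))"
      using card_Un_le[of "X1 p" "X2 p"] by linarith
    ultimately show ?thesis unfolding \<beta>_def by (simp add: distrib_left)
  qed
  have "real (card (\<Union>p\<in>I. X1 p \<union> X2 p)) \<le> (\<Sum>p\<in>I. real (card (X1 p \<union> X2 p)))"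
    using card_UN_le[OF finI, of "\<lambda>p. X1 p \<union> X2 p"] by (simp flip: of_nat_sum)
  also have "\<dots> \<le> real (card I) * (real R ^ card E * \<beta>)"
    using each by (rule sum_bounded_above)
  also have "\<dots> = real R ^ card E * (real r * real (n choose k) * \<beta>)"
    by (simp add: I_def card_cartesian_product)
  also have "\<dots> < real R ^ card E * 1"
    using bound R unfolding \<beta>_def by (intro mult_strict_left_mono) auto
  finally have "card (\<Union>p\<in>I. X1 p \<union> X2 p) < card \<Omega>" using card\<Omega> by simp
  moreover have "finite (\<Union>p\<in>I. X1 p \<union> X2 p)"
    using fin\<Omega> by (rule rev_finite_subset) (auto simp: X1_def X2_def)
  ultimately have "\<not> \<Omega> \<subseteq> (\<Union>p\<in>I. X1 p \<union> X2 p)" by (meson card_mono not_le)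
  then obtain f where f: "f \<in> \<Omega>" "f \<notin> (\<Union>p\<in>I. X1 p \<union> X2 p)" by (meson subsetI)
  show thesis
  proof (rule that)
    fix i S assume iS: "i < r" "S \<in> nsets {..<n} k"
    then have "(i, S) \<in> I" by (simp add: I_def)
    then have n1: "f \<notin> X1 (i, S)" and n2: "f \<notin> X2 (i, S)" using f(2) by blast+
    show "3 * y < card {e\<in>nsets S 2. f e = i}"
      using n1 f(1) by (simp add: X1_def)
    fix \<T> assume "\<T> \<subseteq> triangles_meeting n S" "card \<T> = y" "edge_disjoint \<T>"
    then show "\<exists>\<tau>\<in>\<T>. \<exists>e\<in>nsets \<tau> 2. f e \<noteq> i"
      using n2 f(1) unfolding X2_def fst_conv snd_conv by blast
  qed
qed

text \<open>A triangle of colour \<open>i\<close> surviving the deletion of the packed edges could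
  be added to the maximal packing. Fewer than \<open>y\<close> packed triangles share an edge with a
  given \<open>k\<close>-set, so they destroy fewer than \<open>3 * y\<close> of its more than
  \<open>3 * y\<close> edges of colour \<open>i\<close>. As \<open>n = k * r\<close>, some class of
  \<open>g\<close> contains a \<open>k\<close>-set.\<close>

lemma pattern_from_colouring:
  assumes n: "n = k * r" and r: "r > 0"
    and many: "\<And>i S. i < r \<Longrightarrow> S \<in> nsets {..<n} k \<Longrightarrow> 3 * y < card {e\<in>nsets S 2. f e = (i::nat)}"
    and few: "\<And>i S \<T>. i < r \<Longrightarrow> S \<in> nsets {..<n} k \<Longrightarrow> \<T> \<subseteq> triangles_meeting n S \<Longrightarrow> card \<T> = y \<Longrightarrow>
      edge_disjoint \<T> \<Longrightarrow> \<exists>\<tau>\<in>\<T>. \<exists>e\<in>nsets \<tau> 2. f e \<noteq> i"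
  shows "\<exists>ty. typed_graph r {..<n} ty \<and>
    (\<forall>g. (\<forall>x<n. g x < r) \<longrightarrow> (\<exists>x<n. \<exists>y<n. g x = g y \<and> ty x y = g x))"
proof -
  define Fam where "Fam i = {\<T>. \<T> \<subseteq> nsets {..<n} 3 \<and> edge_disjoint \<T> \<and> (\<forall>\<tau>\<in>\<T>. \<forall>e\<in>nsets \<tau> 2. f e = i)}" for i
  have "\<exists>\<T>\<in>Fam i. \<forall>\<T>'\<in>Fam i. \<T> \<subseteq> \<T>' \<longrightarrow> \<T>' = \<T>" for i
  proof -
    have "finite (Fam i)" "{} \<in> Fam i"
      by (auto simp: Fam_def finite_imp_finite_nsets edge_disjoint_def)
    then show ?thesis using finite_has_maximal[of "Fam i"] by blast
  qed
  then obtain Mx where Mx: "\<And>i. Mx i \<in> Fam i" and max: "\<And>i \<T>'. \<T>' \<in> Fam i \<Longrightarrow> Mx i \<subseteq> \<T>' \<Longrightarrow> \<T>' = Mx i"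
    by metis
  have Mx3: "Mx i \<subseteq> nsets {..<n} 3" and Mx_disj: "edge_disjoint (Mx i)"
    and Mx_col: "\<And>\<tau> e. \<tau> \<in> Mx i \<Longrightarrow> e \<in> nsets \<tau> 2 \<Longrightarrow> f e = i" for i
    using Mx[of i] by (auto simp: Fam_def)
  define cov where "cov i = (\<Union>\<tau>\<in>Mx i. nsets \<tau> 2)" for i
  \<comment> \<open>Surplus colours from \<open>r\<close> on and all packed edges become non-edges,
    of type \<open>r\<close>.\<close>
  define ty where "ty x y = (if x \<noteq> y \<and> f {x, y} < r \<and> {x, y} \<notin> cov (f {x, y}) then f {x, y} else r)" for x y
  have "typed_graph r {..<n} ty"
    unfolding typed_graph_def
  proof (intro conjI ballI allI impI notI)
    fix x y show "ty x y \<le> r" "ty x y = ty y x" by (auto simp: ty_def insert_commute)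
  next
    fix x y z t
    assume xyz: "x \<in> {..<n}" "y \<in> {..<n}" "z \<in> {..<n}" and t: "t < r" "ty x y = t \<and> ty y z = t \<and> ty x z = t"
    have ne: "x \<noteq> y" "y \<noteq> z" "x \<noteq> z" and col: "f {x, y} = t" "f {y, z} = t" "f {x, z} = t"
      and nc: "{x, y} \<notin> cov t" "{y, z} \<notin> cov t" "{x, z} \<notin> cov t"
      using t by (auto simp: ty_def split: if_splits)
    define \<tau> where "\<tau> = {x, y, z}"
    have \<tau>3: "\<tau> \<in> nsets {..<n} 3" using xyz ne by (simp add: \<tau>_def nsets_def)
    have \<tau>2: "nsets \<tau> 2 = {{x, y}, {y, z}, {x, z}}"
      using ne unfolding \<tau>_def nsets_2_eq by (auto simp: insert_commute)
    have off: "nsets \<tau> 2 \<inter> nsets \<tau>' 2 = {}" if "\<tau>' \<in> Mx t" for \<tau>'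
      using nc that unfolding \<tau>2 cov_def by blast
    have "insert \<tau> (Mx t) \<in> Fam t"
      unfolding Fam_def mem_Collect_eq
    proof (intro conjI ballI)
      show "insert \<tau> (Mx t) \<subseteq> nsets {..<n} 3" using \<tau>3 Mx3 by simp
      show "edge_disjoint (insert \<tau> (Mx t))"
        using Mx_disj[of t] off unfolding edge_disjoint_def by (simp add: Int_commute)
      fix \<tau>' e assume "\<tau>' \<in> insert \<tau> (Mx t)" "e \<in> nsets \<tau>' 2"
      then show "f e = t" using Mx_col \<tau>2 col by auto
    qed
    then have "insert \<tau> (Mx t) = Mx t" by (rule max) auto
    then have "nsets \<tau> 2 \<subseteq> cov t" unfolding cov_def by blast
    then show False using nc \<tau>2 by simp
  qed simp
  moreover have "\<exists>x<n. \<exists>y<n. g x = g y \<and> ty x y = g x" if g: "\<forall>x<n. g x < r" for g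
  proof -
    have "\<exists>i\<in>{..<r}. k \<le> card {x\<in>{..<k * card {..<r}}. g x = i}"
      using g r by (intro pigeonhole_fibre) (auto simp: n)
    then obtain i where i: "i < r" "k \<le> card {x\<in>{..<n}. g x = i}" by (auto simp: n)
    then obtain S where S: "S \<subseteq> {x\<in>{..<n}. g x = i}" "card S = k"
      by (meson obtain_subset_with_card_n)
    have Sn: "S \<in> nsets {..<n} k" using S finite_subset[of S "{..<n}"] by (auto simp: nsets_def)
    have finS: "finite S" using Sn by (simp add: nsets_def)
    define N where "N = Mx i \<inter> triangles_meeting n S"
    have finN: "finite N" unfolding N_def using finite_triangles_meeting by simp
    have "card N < y"
    proof (rule ccontr)
      assume "\<not> card N < y"
      then obtain \<T> where \<T>: "\<T> \<subseteq> N" "card \<T> = y" by (meson not_less obtain_subset_with_card_n)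
      have "edge_disjoint \<T>"
        using Mx_disj[of i] \<T>(1) unfolding edge_disjoint_def N_def by blast
      then obtain \<tau> e where "\<tau> \<in> \<T>" "e \<in> nsets \<tau> 2" "f e \<noteq> i"
        using few[OF i(1) Sn _ \<T>(2)] \<T>(1) unfolding N_def by blast
      then show False using Mx_col \<T>(1) unfolding N_def by blast
    qed
    have "\<not> {e\<in>nsets S 2. f e = i} \<subseteq> cov i"
    proof
      assume sub: "{e\<in>nsets S 2. f e = i} \<subseteq> cov i"
      have "{e\<in>nsets S 2. f e = i} \<subseteq> (\<Union>\<tau>\<in>N. nsets \<tau> 2)"
      proof
        fix e assume e: "e \<in> {e\<in>nsets S 2. f e = i}"
        then obtain \<tau> where "\<tau> \<in> Mx i" "e \<in> nsets \<tau> 2" using sub unfolding cov_def by blast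
        moreover from this have "\<tau> \<in> N" using e Mx3 unfolding N_def triangles_meeting_def by blast
        ultimately show "e \<in> (\<Union>\<tau>\<in>N. nsets \<tau> 2)" by blast
      qed
      moreover have N3: "N \<subseteq> nsets {..<n} 3" "edge_disjoint N"
        using Mx3 Mx_disj[of i] unfolding N_def edge_disjoint_def by blast+
      moreover have "finite (\<Union>\<tau>\<in>N. nsets \<tau> 2)"
        using finN N3(1) by (auto simp: nsets_def intro!: finite_imp_finite_nsets[unfolded nsets_def])
      ultimately have "card {e\<in>nsets S 2. f e = i} \<le> 3 * card N"
        using card_Union_edges[OF N3(2) finN N3(1)] by (metis card_mono)
      then show False using many[OF i(1) Sn] \<open>card N < y\<close> by linarith
    qed
    then obtain e where e: "e \<in> nsets S 2" "f e = i" "e \<notin> cov i" by blast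
    then obtain x z where xz: "e = {x, z}" "x \<in> S" "z \<in> S" "x \<noteq> z" by (meson nsets2_E)
    have "ty x z = i" using e xz i(1) by (simp add: ty_def)
    moreover have "x < n" "z < n" "g x = i" "g z = i" using S(1) xz by auto
    ultimately show ?thesis by metis
  qed
  ultimately show ?thesis by blast
qed

text \<open>With \<open>R = 13824 * l * r\<close> colours on the edges of the complete graph on \<open>n = k * r\<close> vertices, where
  \<open>k = 96 * l * R\<close>, a fixed \<open>k\<close>-set has few edges of a given colour with probability at most
  \<open>exp (- 3 * k * l)\<close>, and the same bound holds for \<open>3 * k * l\<close> edge-disjoint triangles of that colour
  meeting it; the number of \<open>k\<close>-sets is at most \<open>exp (k * l)\<close>.\<close>

lemma union_bound:
  fixes r l :: nat
  assumes r: "r \<ge> 2" and l: "1 + ln (real r) \<le> real l"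
  defines "R \<equiv> 13824 * l * r"
  defines "k \<equiv> 96 * l * R"
  defines "n \<equiv> k * r" and "y \<equiv> 3 * k * l"
  shows "real r * real (n choose k) * (2 ^ (3 * y) * (1 - 1 / (2 * real R)) ^ (k choose 2)
      + real (((k choose 2) * n) choose y) / real R ^ (3 * y)) < 1"
proof -
  have lnr: "ln (real r) \<ge> 0" using r by simp
  have l0: "l > 0" using l lnr by linarith
  have R0: "R > 0" using l0 r by (simp add: R_def)
  have k0: "k \<ge> 96" using l0 R0 by (simp add: k_def)
  have n0: "n > 0" using k0 r by (simp add: n_def)
  have y0: "y > 0" using k0 l0 by (simp add: y_def)
  have K: "real (k choose 2) = real k * (real k - 1) / 2"
    using k0 by (simp add: choose_two real_of_nat_div of_nat_diff)
  have K_lower: "real (k choose 2) \<ge> real k * real k / 4"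
  proof -
    have "real k * (real k / 2) \<le> real k * (real k - 1)" using k0 by (intro mult_left_mono) auto
    then show ?thesis unfolding K by simp
  qed
  have K_upper: "real (k choose 2) \<le> real k * real k / 2" unfolding K by (simp add: mult_left_mono)
  have sets: "real (n choose k) \<le> exp (real k * real l)"
  proof -
    have "real (n choose k) \<le> (exp 1 * real n / real k) ^ k"
      using n0 k0 by (intro binomial_le_exp_power) auto
    also have "exp 1 * real n / real k = exp (1 + ln (real r))"
      using k0 r by (simp add: n_def exp_add)
    also have "\<dots> ^ k \<le> exp (real l) ^ k" using l by (intro power_mono) auto
    finally show ?thesis by (simp flip: exp_of_nat_mult)
  qed
  \<comment> \<open>The edge density gives the exponent \<open>- 12 * k * l\<close>, of which
    \<open>2 ^ (3 * y)\<close> costs at most \<open>9 * k * l\<close>; the constant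
    \<open>96\<close> is chosen for this.\<close>
  have edges: "2 ^ (3 * y) * (1 - 1 / (2 * real R)) ^ (k choose 2) \<le> exp (- 3 * real k * real l)"
  proof -
    have "(1 - 1 / (2 * real R)) ^ (k choose 2) \<le> exp (- 1 / (2 * real R)) ^ (k choose 2)"
      using R0 exp_ge_add_one_self[of "- 1 / (2 * real R)"] by (intro power_mono) (auto simp: field_simps)
    also have "\<dots> = exp (- real (k choose 2) / (2 * real R))" by (simp flip: exp_of_nat_mult)
    also have "\<dots> \<le> exp (- 12 * real k * real l)"
    proof -
      have "12 * real k * real l * (2 * real R) = real k * real k / 4"
        by (simp add: k_def)
      then have "12 * real k * real l * (2 * real R) \<le> real (k choose 2)" using K_lower by linarith
      then have "12 * real k * real l \<le> real (k choose 2) / (2 * real R)"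
        using R0 by (subst pos_le_divide_eq) auto
      then show ?thesis by simp
    qed
    finally have 1: "(1 - 1 / (2 * real R)) ^ (k choose 2) \<le> exp (- 12 * real k * real l)" .
    have "(2::real) ^ (3 * y) \<le> exp 1 ^ (3 * y)"
      using exp_ge_add_one_self[of 1] by (intro power_mono) auto
    also have "\<dots> = exp (9 * real k * real l)"
      by (simp add: y_def flip: exp_of_nat_mult)
    finally have "2 ^ (3 * y) * (1 - 1 / (2 * real R)) ^ (k choose 2)
        \<le> exp (9 * real k * real l) * exp (- 12 * real k * real l)"
      using 1 R0 by (intro mult_mono) (auto simp: field_simps)
    also have "\<dots> = exp (- 3 * real k * real l)" by (simp flip: exp_add)
    finally show ?thesis .
  qed
  have triangles: "real (((k choose 2) * n) choose y) / real R ^ (3 * y) \<le> exp (- 3 * real k * real l)"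
  proof -
    define m where "m = (k choose 2) * n"
    have m0: "m > 0" using k0 n0 by (simp add: m_def)
    have "real (m choose y) / real R ^ (3 * y) \<le> (exp 1 * real m / real y) ^ y / real R ^ (3 * y)"
      using binomial_le_exp_power[OF m0 y0] by (intro divide_right_mono) auto
    also have "\<dots> = (exp 1 * (real m / (real y * real R ^ 3))) ^ y"
      unfolding power_mult by (simp add: power_divide power_mult_distrib)
    also have "\<dots> \<le> exp (-1) ^ y"
    proof (intro power_mono)
      have "real m \<le> real k * real k / 2 * real n"
        unfolding m_def of_nat_mult using K_upper by (intro mult_right_mono) auto
      \<comment> \<open>This equality fixes \<open>13824\<close>: with
        \<open>k = 96 * l * R\<close>, the equation \<open>k ^ 3 * r / 2 = y * R ^ 3 / 9\<close>
        reduces to \<open>R = 3 * 4608 * l * r\<close>. The factor \<open>1 / 9\<close> is small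
        enough for \<open>exp 1 / 9 \<le> exp (-1)\<close>.\<close>
      also have "\<dots> = real y * real R ^ 3 / 9"
        by (simp add: n_def y_def k_def R_def power3_eq_cube)
      finally have "real m / (real y * real R ^ 3) \<le> 1 / 9"
        using y0 R0 by (simp add: field_simps)
      then have "exp 1 * (real m / (real y * real R ^ 3)) \<le> exp 1 * (1 / 9)" by (rule mult_left_mono) simp
      also have "\<dots> \<le> exp (-1 :: real)"
      proof -
        have "exp 1 * exp 1 \<le> (3 * 3 :: real)" using exp_le by (intro mult_mono) auto
        then show ?thesis by (simp add: exp_minus field_simps)
      qed
      finally show "exp 1 * (real m / (real y * real R ^ 3)) \<le> exp (-1)" .
    qed auto
    also have "\<dots> = exp (- 3 * real k * real l)" by (simp add: y_def flip: exp_of_nat_mult)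
    finally show ?thesis by (simp add: m_def)
  qed
  have "real r * real (n choose k) * (2 ^ (3 * y) * (1 - 1 / (2 * real R)) ^ (k choose 2)
      + real (((k choose 2) * n) choose y) / real R ^ (3 * y))
      \<le> real r * exp (real k * real l) * (exp (- 3 * real k * real l) + exp (- 3 * real k * real l))"
    using sets edges triangles R0 by (intro mult_mono add_mono) (auto simp: field_simps)
  also have "\<dots> = 2 * real r * exp (- 2 * (real k * real l))"
    by (simp add: algebra_simps flip: exp_add)
  also have "\<dots> < 1"
  proof -
    have "real k * real l \<ge> 1 * real l" using k0 by (intro mult_right_mono) auto
    then have "1 + ln (real r) \<le> real k * real l" using l by simp
    then have kl: "2 * (1 + ln (real r)) \<le> 2 * (real k * real l)" by (rule mult_left_mono) simp
    have "2 * real r < 4 * (real r * real r)" using r by simp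
    also have "\<dots> \<le> (exp 1 * real r) * (exp 1 * real r)"
    proof -
      have "(2::real) \<le> exp 1" using exp_ge_add_one_self[of "1::real"] by simp
      then have "(2 * real r) * (2 * real r) \<le> (exp 1 * real r) * (exp 1 * real r)"
        by (intro mult_mono) auto
      then show ?thesis by simp
    qed
    also have "\<dots> = exp ((1 + ln (real r)) + (1 + ln (real r)))"
      unfolding exp_add using r by simp
    also have "\<dots> \<le> exp (2 * (real k * real l))" using kl by simp
    finally show ?thesis by (simp add: exp_minus field_simps)
  qed
  finally show ?thesis .
qed

lemma pattern_exists:
  assumes r: "r \<ge> 2"
  obtains n ty where "real n \<le> 5 * 10 ^ 11 * real r ^ 2 * ln (real r) ^ 2" "typed_graph r {..<n} ty"
    "\<And>g. \<forall>x<n. g x < r \<Longrightarrow> \<exists>x<n. \<exists>y<n. g x = g y \<and> ty x y = g x"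
proof -
  define l where "l = nat \<lceil>1 + ln (real r)\<rceil>"
  define R where "R = 13824 * l * r"
  define k where "k = 96 * l * R"
  have l: "1 + ln (real r) \<le> real l" unfolding l_def by (rule real_nat_ceiling_ge)
  \<comment> \<open>A positive lower bound on \<open>ln r\<close> absorbs the additive constants:
    \<open>l < 2 + ln r \<le> 5 * ln r\<close>.\<close>
  have ln2: "ln (real r) \<ge> 1/2"
  proof -
    have "exp (1/2 :: real) * exp (1/2) = exp 1" by (simp flip: exp_add)
    then have "exp (1/2 :: real) * exp (1/2) \<le> 2 * 2" using exp_le by simp
    then have "exp (1/2 :: real) \<le> 2" by (rule_tac ccontr) (use mult_strict_mono[of 2 "exp (1/2)" 2 "exp (1/2 :: real)"] in simp)
    then show ?thesis using r by (subst ln_ge_iff) auto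
  qed
  have lu: "real l \<le> 6 * ln (real r)"
  proof -
    have "real l < 1 + ln (real r) + 1" unfolding l_def using ln2 by linarith
    then show ?thesis using ln2 by linarith
  qed
  have lr: "r \<le> R" "R > 0" using l ln2 r by (auto simp: R_def)
  have "\<exists>ty. typed_graph r {..<k * r} ty \<and>
    (\<forall>g. (\<forall>x<k * r. g x < r) \<longrightarrow> (\<exists>x<k * r. \<exists>y<k * r. g x = g y \<and> ty x y = g x))"
  proof (rule good_colouring_exists[OF lr(1) union_bound[OF r l, folded R_def, folded k_def] lr(2)])
    fix f
    assume many: "\<And>i S. i < r \<Longrightarrow> S \<in> nsets {..<k * r} k \<Longrightarrow>
        3 * (3 * k * l) < card {e \<in> nsets S 2. f e = (i::nat)}"
    and few: "\<And>i S \<T>. i < r \<Longrightarrow> S \<in> nsets {..<k * r} k \<Longrightarrow> \<T> \<subseteq> triangles_meeting (k * r) S \<Longrightarrow>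
        card \<T> = 3 * k * l \<Longrightarrow> edge_disjoint \<T> \<Longrightarrow> \<exists>\<tau>\<in>\<T>. \<exists>e\<in>nsets \<tau> 2. f e \<noteq> i"
    show ?thesis
    proof (rule pattern_from_colouring[OF refl])
      show "r > 0" using r by simp
      show "3 * (3 * k * l) < card {e \<in> nsets S 2. f e = i}"
        if "i < r" "S \<in> nsets {..<k * r} k" for i S
        using that by (rule many)
      show "\<exists>\<tau>\<in>\<T>. \<exists>e\<in>nsets \<tau> 2. f e \<noteq> i"
        if "i < r" "S \<in> nsets {..<k * r} k" "\<T> \<subseteq> triangles_meeting (k * r) S"
          "card \<T> = 3 * k * l" "edge_disjoint \<T>" for i S \<T>
        using that by (rule few)
    qed
  qed
  then obtain ty where ty: "typed_graph r {..<k * r} ty"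
    "\<forall>g. (\<forall>x<k * r. g x < r) \<longrightarrow> (\<exists>x<k * r. \<exists>y<k * r. g x = g y \<and> ty x y = g x)"
    by (elim exE conjE)
  \<comment> \<open>\<open>1327104 = 96 * 13824\<close>; multiplied by \<open>6 ^ 2\<close> it stays
    far below the final constant.\<close>
  have "real (k * r) = 1327104 * real r ^ 2 * real l ^ 2"
    by (simp add: k_def R_def power2_eq_square)
  also have "\<dots> \<le> 1327104 * real r ^ 2 * (6 * ln (real r)) ^ 2"
    using lu by (intro mult_left_mono power_mono) auto
  also have "\<dots> \<le> 5 * 10 ^ 11 * real r ^ 2 * ln (real r) ^ 2"
    by (simp add: power_mult_distrib mult_right_mono)
  finally have "real (k * r) \<le> 5 * 10 ^ 11 * real r ^ 2 * ln (real r) ^ 2" .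
  then show thesis
    by (rule that[OF _ ty(1)]) (rule ty(2)[THEN spec, THEN mp])
qed

section \<open>The bounds on the smallest minimum degree\<close>

theorem theorem1:
  shows "\<exists>c C :: real. c > 0 \<and> C > 0 \<and>
    (\<forall>r::nat. r \<ge> 2 \<longrightarrow>
       c * real r ^ 2 * ln (real r) \<le> real (s_r r K3_V K3_E) \<and>
       real (s_r r K3_V K3_E) \<le> C * real r ^ 2 * (ln (real r)) ^ 2)"
proof (rule exI[of _ "1 / 100000"], rule exI[of _ "5 * 10 ^ 11"], intro conjI allI impI)
  fix r :: nat assume r: "r \<ge> 2"
  define D where "D = {min_degree V E | (V :: nat set) E. ramsey_minimal r V E K3_V K3_E}"
  have s: "s_r r K3_V K3_E = Inf D" by (simp add: s_r_def D_def)
  obtain n ty where n: "real n \<le> 5 * 10 ^ 11 * real r ^ 2 * ln (real r) ^ 2"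
    and tg: "typed_graph r {..<n} ty"
    and un: "\<And>g. \<forall>x<n. g x < r \<Longrightarrow> \<exists>x<n. \<exists>y<n. g x = g y \<and> ty x y = g x"
    by (rule pattern_exists[OF r]) blast
  have "\<exists>(V :: nat set) E. ramsey_minimal r V E K3_V K3_E \<and> min_degree V E \<le> n"
    by (rule ramsey_minimal_from_pattern[OF r tg]) (rule un)
  then obtain V :: "nat set" and E where VE: "ramsey_minimal r V E K3_V K3_E" "min_degree V E \<le> n"
    by (elim exE conjE)
  have inD: "min_degree V E \<in> D" unfolding D_def using VE(1) by blast
  then have "Inf D \<le> min_degree V E" by (intro cInf_lower) auto
  then show "real (s_r r K3_V K3_E) \<le> 5 * 10 ^ 11 * real r ^ 2 * ln (real r) ^ 2"
    using VE(2) n unfolding s by linarith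
  \<comment> \<open>The graph just constructed makes \<open>D\<close> non-empty, so the infimum is
    attained and the degree bound for a single minimal graph applies to it.\<close>
  have "Inf D \<in> D" using inD by (intro Inf_nat_def1) blast
  then obtain V' :: "nat set" and E' where "ramsey_minimal r V' E' K3_V K3_E" "Inf D = min_degree V' E'"
    unfolding D_def by blast
  then show "1 / 100000 * real r ^ 2 * ln (real r) \<le> real (s_r r K3_V K3_E)"
    using ramsey_minimal_min_degree_lower[OF r, of V' E'] unfolding s by simp
qed simp_all

end
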